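(* Let $G$ be a $2$-connected outerplanar graph with $\Delta(G)=3$. Then $G$ is interval colorable (i.e. $G\in\mathfrak{N}$) and $$w(G)=\begin{cases}3, & \text{if } |V(G)| \text{ is even},\\ 4, & \text{if } |V(G)| \text{ is odd}.\end{cases}$$
   Context: All graphs are finite, undirected, without loops or multiple edges. $\Delta(G)$ is the maximum degree of $G$. A graph is outerplanar if it can be embedded in the plane so that all its vertices lie on the same (unbounded) face. For a proper edge-coloring $\alpha$ of $G$ (adjacent edges receive different colors) and a vertex $v$, $S(v,\alpha)$ denotes the set of colors of edges incident to $v$. A proper edge-coloring $\alpha$ of $G$ with colors $1,\ldots,t$ is an interval $t$-coloring if all colors $1,\ldots,t$ are used and, for every vertex $v$ of $G$, $S(v,\alpha)$ is an interval of integers (a set of consecutive integers). $G$ is interval colorable if it has an interval $t$-coloring for some positive integer $t$; $\mathfrak{N}$ is the set of all interval colorable graphs. For $G\in\mathfrak{N}$, $w(G)$ is the least $t$ for which $G$ has an interval $t$-coloring. *)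

theory Defs
  imports "HOL-Analysis.Analysis"
begin

text \<open>A graph is given by its vertex set and its edge set, an edge being the set of its two ends.\<close>

definition simple_graph :: "'a set \<Rightarrow> 'a set set \<Rightarrow> bool" where
  "simple_graph V E \<longleftrightarrow> finite V \<and> (\<forall>e\<in>E. e \<subseteq> V \<and> card e = 2)"

definition vertex_degree :: "'a set set \<Rightarrow> 'a \<Rightarrow> nat" where
  "vertex_degree E v = card {e \<in> E. v \<in> e}"

definition max_degree :: "'a set \<Rightarrow> 'a set set \<Rightarrow> nat" where
  "max_degree V E = Max (vertex_degree E ` V)"

definition connected_graph :: "'a set \<Rightarrow> 'a set set \<Rightarrow> bool" where
  "connected_graph V E \<longleftrightarrow>
     V \<noteq> {} \<and> (\<forall>u\<in>V. \<forall>v\<in>V. (u, v) \<in> {(x, y). {x, y} \<in> E}\<^sup>*)"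

definition two_connected :: "'a set \<Rightarrow> 'a set set \<Rightarrow> bool" where
  "two_connected V E \<longleftrightarrow>
     card V \<ge> 3 \<and> connected_graph V E \<and>
     (\<forall>v\<in>V. connected_graph (V - {v}) {e \<in> E. v \<notin> e})"

text \<open>Vertices are drawn as distinct points of the plane and edges as simple arcs between their
  ends; arcs meet vertices and each other only in common ends.\<close>

definition plane_embedding ::
    "'a set \<Rightarrow> 'a set set \<Rightarrow> ('a \<Rightarrow> complex) \<Rightarrow> ('a set \<Rightarrow> real \<Rightarrow> complex) \<Rightarrow> bool" where
  "plane_embedding V E p g \<longleftrightarrow>
     inj_on p V \<and>
     (\<forall>e\<in>E. arc (g e) \<and> {pathstart (g e), pathfinish (g e)} = p ` e \<and>
            path_image (g e) \<inter> p ` V = p ` e) \<and>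
     (\<forall>e\<in>E. \<forall>e'\<in>E. e \<noteq> e' \<longrightarrow>
            path_image (g e) \<inter> path_image (g e') = p ` (e \<inter> e'))"

definition drawing ::
    "'a set \<Rightarrow> 'a set set \<Rightarrow> ('a \<Rightarrow> complex) \<Rightarrow> ('a set \<Rightarrow> real \<Rightarrow> complex) \<Rightarrow> complex set" where
  "drawing V E p g = p ` V \<union> (\<Union>e\<in>E. path_image (g e))"

text \<open>The faces of an embedding are the components of the complement of its drawing; a vertex
  lies on a face if its point belongs to the boundary of that face.\<close>

definition outerplanar :: "'a set \<Rightarrow> 'a set set \<Rightarrow> bool" where
  "outerplanar V E \<longleftrightarrow>
     (\<exists>p g. plane_embedding V E p g \<and>
        (\<exists>F \<in> components (- drawing V E p g). \<not> bounded F \<and> p ` V \<subseteq> frontier F))"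

definition proper_edge_coloring :: "'a set set \<Rightarrow> ('a set \<Rightarrow> nat) \<Rightarrow> bool" where
  "proper_edge_coloring E \<alpha> \<longleftrightarrow>
     (\<forall>e\<in>E. \<forall>e'\<in>E. e \<noteq> e' \<and> e \<inter> e' \<noteq> {} \<longrightarrow> \<alpha> e \<noteq> \<alpha> e')"

definition spectrum_at :: "'a set set \<Rightarrow> ('a set \<Rightarrow> nat) \<Rightarrow> 'a \<Rightarrow> nat set" where
  "spectrum_at E \<alpha> v = \<alpha> ` {e \<in> E. v \<in> e}"

text \<open>The empty spectrum of an isolated vertex counts as an interval.\<close>

definition interval_coloring ::
    "'a set \<Rightarrow> 'a set set \<Rightarrow> nat \<Rightarrow> ('a set \<Rightarrow> nat) \<Rightarrow> bool" where
  "interval_coloring V E t \<alpha> \<longleftrightarrow>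
     proper_edge_coloring E \<alpha> \<and> \<alpha> ` E = {1..t} \<and>
     (\<forall>v\<in>V. \<exists>a b. spectrum_at E \<alpha> v = {a..b})"

definition interval_colorable :: "'a set \<Rightarrow> 'a set set \<Rightarrow> bool" where
  "interval_colorable V E \<longleftrightarrow> (\<exists>t\<ge>1. \<exists>\<alpha>. interval_coloring V E t \<alpha>)"

text \<open>Meaningful only for interval colorable graphs.\<close>

definition min_interval_colors :: "'a set \<Rightarrow> 'a set set \<Rightarrow> nat" where
  "min_interval_colors V E = (LEAST t. t \<ge> 1 \<and> (\<exists>\<alpha>. interval_coloring V E t \<alpha>))"

end

theory Submission
  imports Defs
begin

text \<open>A 2-connected outerplanar graph is a Hamiltonian cycle together with pairwise noncrossing chords,
  and if the maximum degree is 3, then no two chords share an end. The rest is a statement about such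
  chord diagrams.

  Both properties of the cycle follow from one fact of plane topology
  (\<open>theta_some_arc_inside\<close>): among three arcs with common ends that are otherwise disjoint, one is
  enclosed by the other two. In an outerplanar drawing a path with an inner vertex cannot be enclosed.
  So there are no three parallel paths with inner vertices, which makes every longest cycle
  Hamiltonian (\<open>outerplanar_two_connected_hamiltonian\<close>), and every chord of a cycle runs inside
  the cycle, where two chords cannot cross (\<open>no_crossing_chords\<close>).

  A vertex of degree 3 needs three colours. In an interval colouring with three colours, every vertex
  sees colour 2, so these edges form a perfect matching and the order is even
  (\<open>interval_3_coloring_even\<close>). If the order is even, the cycle is coloured 1, 2, 1, 2, ... and
  all chords 3. If it is odd, then four colours suffice: each chord cuts off an odd arc on one side,
  and a shortest odd arc has, near one of its ends, two consecutive parts (vertices of degree 2, or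
  segments cut off by chords) around which the colours can be shifted so as to correct the parity of
  the cycle (\<open>odd_interval_4_coloring\<close>).\<close>

section \<open>Theta graphs in the plane\<close>

lemma jordan_two_arcs:
  fixes c1 c2 :: "real \<Rightarrow> complex"
  assumes "arc c1" "pathstart c1 = a" "pathfinish c1 = b"
    and "arc c2" "pathstart c2 = a" "pathfinish c2 = b"
    and "path_image c1 \<inter> path_image c2 = {a, b}"
  defines "J \<equiv> path_image c1 \<union> path_image c2"
  shows "inside J \<noteq> {}" "open (inside J)" "connected (inside J)"
    "open (outside J)" "frontier (inside J) = J" "closed J"
proof -
  have s: "simple_path (c1 +++ reversepath c2)"
    by (rule simple_path_join_loop) (use assms in \<open>auto simp: arc_reversepath\<close>)
  have p: "path_image (c1 +++ reversepath c2) = J"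
    using assms by (simp add: path_image_join)
  show "inside J \<noteq> {}" "open (inside J)" "connected (inside J)"
    "open (outside J)" "frontier (inside J) = J"
    using Jordan_inside_outside[OF s] p assms by auto
  show "closed J"
    using p s closed_simple_path_image by metis
qed

lemma connected_inside_or_outside:
  fixes J C :: "complex set"
  assumes "connected C" "C \<inter> J = {}" "closed J"
  shows "C \<subseteq> inside J \<or> C \<subseteq> outside J"
proof -
  have "C \<subseteq> inside J \<union> outside J" using assms(2) by auto
  moreover have "inside J \<inter> outside J = {}" by auto
  moreover have "open (inside J)" "open (outside J)"
    using assms(3) by (auto intro: open_inside open_outside)
  ultimately show ?thesis
    using assms(1) connectedD[of C "inside J" "outside J"] by blast
qed

text \<open>In a theta graph whose second and third arcs avoid the insides of the cycles formed by the other
  two, the inside of one cycle cannot overlap the inside of a second one: it is connected, misses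
  the second cycle altogether, and its boundary contains an arc running outside that cycle.\<close>

lemma theta_region_outside:
  fixes c1 c2 c3 :: "real \<Rightarrow> complex"
  assumes c1: "arc c1" "pathstart c1 = a" "pathfinish c1 = b"
    and c2: "arc c2" "pathstart c2 = a" "pathfinish c2 = b"
    and c3: "arc c3" "pathstart c3 = a" "pathfinish c3 = b"
    and i12: "path_image c1 \<inter> path_image c2 = {a, b}"
    and i13: "path_image c1 \<inter> path_image c3 = {a, b}"
    and o3: "path_image c3 - {a, b} \<subseteq> outside (path_image c1 \<union> path_image c2)"
    and o2: "path_image c2 - {a, b} \<subseteq> outside (path_image c1 \<union> path_image c3)"
  shows "inside (path_image c1 \<union> path_image c2) \<subseteq> outside (path_image c1 \<union> path_image c3)"
proof -
  let ?I = "inside (path_image c1 \<union> path_image c2)"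
  let ?O = "outside (path_image c1 \<union> path_image c3)"
  note J12 = jordan_two_arcs[OF c1 c2 i12] and J13 = jordan_two_arcs[OF c1 c3 i13]
  have "a \<noteq> b" using c1 arc_distinct_ends by metis
  have "path_image c2 - {a, b} \<noteq> {}"
  proof -
    have "c2 ` {0<..<1} \<noteq> {}" by simp
    then show ?thesis using simple_path_endless[OF arc_imp_simple_path[OF c2(1)]] c2 by auto
  qed
  then obtain x where x: "x \<in> path_image c2" "x \<in> ?O" using o2 by auto
  have "x \<in> closure ?I" using J12(5) x(1) by (auto simp: frontier_def)
  then have ne: "?I \<inter> ?O \<noteq> {}"
    using J13(4) x(2) open_Int_closure_eq_empty by blast
  have "?I \<inter> (path_image c1 \<union> path_image c3) = {}"
  proof -
    have "?I \<inter> (path_image c1 \<union> path_image c2) = {}" by simp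
    moreover have "?I \<inter> (path_image c3 - {a, b}) = {}"
      using o3 inside_Int_outside by blast
    ultimately show ?thesis using i12 by blast
  qed
  then have "?I \<subseteq> inside (path_image c1 \<union> path_image c3) \<or> ?I \<subseteq> ?O"
    using connected_inside_or_outside J12(3) J13(6) by blast
  then show ?thesis using ne by (metis inside_Int_outside disjoint_iff subset_iff)
qed

text \<open>The middle arc of a theta graph. If no arc were enclosed by the other two, then a point inside the
  cycle of the first two arcs would lie outside the two other cycles, by the preceding lemma, just
  as a point far away does. These two cycles meet in the connected third arc, so Janiszewski's
  theorem would join the two points in the complement of the whole theta graph, although the first
  cycle separates them.\<close>

lemma theta_some_arc_inside:
  fixes c1 c2 c3 :: "real \<Rightarrow> complex"
  assumes c1: "arc c1" "pathstart c1 = a" "pathfinish c1 = b"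
    and c2: "arc c2" "pathstart c2 = a" "pathfinish c2 = b"
    and c3: "arc c3" "pathstart c3 = a" "pathfinish c3 = b"
    and i12: "path_image c1 \<inter> path_image c2 = {a, b}"
    and i13: "path_image c1 \<inter> path_image c3 = {a, b}"
    and i23: "path_image c2 \<inter> path_image c3 = {a, b}"
  shows "path_image c1 - {a, b} \<subseteq> inside (path_image c2 \<union> path_image c3) \<or>
    path_image c2 - {a, b} \<subseteq> inside (path_image c1 \<union> path_image c3) \<or>
    path_image c3 - {a, b} \<subseteq> inside (path_image c1 \<union> path_image c2)"
proof (rule ccontr)
  assume no: "\<not> ?thesis"
  note J12 = jordan_two_arcs[OF c1 c2 i12] and J13 = jordan_two_arcs[OF c1 c3 i13]
    and J23 = jordan_two_arcs[OF c2 c3 i23]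
  have con: "connected (path_image c - {a, b})" if "arc c" "pathstart c = a" "pathfinish c = b" for c
    using connected_simple_path_endless[OF arc_imp_simple_path[OF that(1)]] that by simp
  have o1: "path_image c1 - {a, b} \<subseteq> outside (path_image c2 \<union> path_image c3)"
    using connected_inside_or_outside[OF con[OF c1] _ J23(6)] no i12 i13 by blast
  have o2: "path_image c2 - {a, b} \<subseteq> outside (path_image c1 \<union> path_image c3)"
    using connected_inside_or_outside[OF con[OF c2] _ J13(6)] no i12 i23 by blast
  have o3: "path_image c3 - {a, b} \<subseteq> outside (path_image c1 \<union> path_image c2)"
    using connected_inside_or_outside[OF con[OF c3] _ J12(6)] no i13 i23 by blast
  obtain p where p: "p \<in> inside (path_image c1 \<union> path_image c2)" using J12(1) by blast
  have p13: "p \<in> outside (path_image c1 \<union> path_image c3)"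
    using theta_region_outside[OF c1 c2 c3 i12 i13 o3 o2] p by blast
  have p23: "p \<in> outside (path_image c2 \<union> path_image c3)"
    using theta_region_outside[OF c2 c1 c3 _ i23 _ o1] o3 p i12
    by (metis Int_commute Un_commute subset_iff)
  let ?T = "path_image c1 \<union> path_image c2 \<union> path_image c3"
  have cT: "compact ?T" using c1 c2 c3 by (simp add: compact_Un compact_arc_image)
  have "\<exists>q. q \<in> outside ?T"
    using compact_imp_bounded[OF cT] outside_bounded_nonempty by blast
  then obtain q where q: "q \<in> outside ?T" by blast
  have qo: "q \<in> outside S" if "S \<subseteq> ?T" for S using q outside_mono[OF that] by blast
  have comp: "connected_component (- S) p q"
    if "p \<in> outside S" "q \<in> outside S" "bounded S" for S :: "complex set"
  proof -
    have "connected (outside S)" by (rule connected_outside[OF that(3)]) simp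
    moreover have "outside S \<subseteq> - S" using outside_no_overlap[of S] by blast
    ultimately show ?thesis using that unfolding connected_component_def by blast
  qed
  \<comment> \<open>the two cycles that do not separate p from q share exactly the third arc\<close>
  have int: "(path_image c1 \<union> path_image c3) \<inter> (path_image c2 \<union> path_image c3) = path_image c3"
    using i12 i13 by blast
  have "connected_component (- ((path_image c1 \<union> path_image c3) \<union> (path_image c2 \<union> path_image c3))) p q"
  proof (rule Janiszewski)
    show "compact (path_image c1 \<union> path_image c3)" using c1 c3 by (simp add: compact_Un compact_arc_image)
    show "closed (path_image c2 \<union> path_image c3)" by (rule J23(6))
    show "connected ((path_image c1 \<union> path_image c3) \<inter> (path_image c2 \<union> path_image c3))"
      unfolding int using c3 by (simp add: connected_arc_image)
    show "connected_component (- (path_image c1 \<union> path_image c3)) p q"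
      by (rule comp) (use p13 qo c1 c3 in \<open>auto simp: bounded_arc_image\<close>)
    show "connected_component (- (path_image c2 \<union> path_image c3)) p q"
      by (rule comp) (use p23 qo c2 c3 in \<open>auto simp: bounded_arc_image\<close>)
  qed
  then have "connected_component (- (path_image c1 \<union> path_image c2)) p q"
    by (rule connected_component_of_subset) auto
  moreover have "q \<in> outside (path_image c1 \<union> path_image c2)" by (rule qo) auto
  ultimately show False
    using p unfolding inside_def outside_def
    using connected_component_eq[of q "- (path_image c1 \<union> path_image c2)" p] by auto
qed

lemma inside_avoids_closure_of_unbounded:
  fixes J F :: "complex set"
  assumes "connected F" "\<not> bounded F" "F \<inter> J = {}" "compact J"
  shows "inside J \<inter> closure F = {}"
proof -
  have "\<not> F \<subseteq> inside J"
    using assms(2,4) bounded_subset bounded_inside compact_imp_bounded by blast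
  then have "F \<subseteq> outside J"
    using connected_inside_or_outside[OF assms(1,3)] assms(4) compact_imp_closed by blast
  then have "inside J \<inter> F = {}" using inside_Int_outside by blast
  then show ?thesis
    using open_Int_closure_eq_empty open_inside assms(4) compact_imp_closed by metis
qed

section \<open>Paths as lists of vertices\<close>

fun path_edges :: "'a list \<Rightarrow> 'a set set" where
  "path_edges (x # y # zs) = insert {x, y} (path_edges (y # zs))"
| "path_edges _ = {}"

lemma path_edges_subset_set: "e \<in> path_edges xs \<Longrightarrow> e \<subseteq> set xs"
  by (induction xs rule: path_edges.induct) auto

lemma path_edges_append: "path_edges (xs @ x # ys) = path_edges (xs @ [x]) \<union> path_edges (x # ys)"
  by (induction xs rule: path_edges.induct) auto

lemma path_edges_Cons: "xs \<noteq> [] \<Longrightarrow> path_edges (x # xs) = insert {x, hd xs} (path_edges xs)"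
  by (cases xs) auto

lemma path_edges_snoc: "xs \<noteq> [] \<Longrightarrow> path_edges (xs @ [x]) = insert {last xs, x} (path_edges xs)"
  by (induction xs rule: path_edges.induct) auto

lemma path_edges_rev: "path_edges (rev xs) = path_edges xs"
proof (induction xs rule: path_edges.induct)
  case (1 x y zs)
  have "path_edges (rev (x # y # zs)) = insert {y, x} (path_edges (rev (y # zs)))"
    using path_edges_snoc[of "rev (y # zs)" x] by simp
  then show ?case using 1 by (simp add: insert_commute)
qed auto

lemma vertex_on_path_edge: "x \<in> set xs \<Longrightarrow> length xs \<ge> 2 \<Longrightarrow> \<exists>e\<in>path_edges xs. x \<in> e"
proof (induction xs rule: path_edges.induct)
  case (1 x' y zs)
  then show ?case by (cases zs) auto
qed auto

lemma end_edge_path: "distinct (a # X @ [b]) \<Longrightarrow> {a, b} \<in> path_edges (a # X @ [b]) \<Longrightarrow> X = []"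
proof (cases X)
  case (Cons x X')
  assume a: "distinct (a # X @ [b])" "{a, b} \<in> path_edges (a # X @ [b])"
  then have "{a, b} = {a, x} \<or> {a, b} \<subseteq> set (x # X' @ [b])"
    using Cons path_edges_subset_set by fastforce
  then show ?thesis using a(1) Cons by (auto simp: doubleton_eq_iff)
qed

section \<open>Drawings with all vertices on the outer face\<close>

text \<open>Only three properties of the outer face matter: it is connected and unbounded, it avoids the
  drawing, and every vertex is in its closure.\<close>

locale outerplane_drawing =
  fixes V :: "'a set" and E :: "'a set set" and p :: "'a \<Rightarrow> complex"
    and g :: "'a set \<Rightarrow> real \<Rightarrow> complex" and F :: "complex set"
  assumes simple: "simple_graph V E"
    and embedding: "plane_embedding V E p g"
    and connected_F: "connected F" and unbounded_F: "\<not> bounded F"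
    and F_avoids: "F \<inter> drawing V E p g = {}"
    and on_F: "p ` V \<subseteq> closure F"
begin

definition path_trace :: "'a list \<Rightarrow> complex set" where
  "path_trace xs = (\<Union>e\<in>path_edges xs. path_image (g e))"

lemma edge_arc: "e \<in> E \<Longrightarrow> arc (g e)"
  and edge_ends: "e \<in> E \<Longrightarrow> {pathstart (g e), pathfinish (g e)} = p ` e"
  and edges_meet: "e \<in> E \<Longrightarrow> e' \<in> E \<Longrightarrow> e \<noteq> e' \<Longrightarrow>
    path_image (g e) \<inter> path_image (g e') = p ` (e \<inter> e')"
  and edge_subset: "e \<in> E \<Longrightarrow> e \<subseteq> V"
  and edge_card: "e \<in> E \<Longrightarrow> card e = 2"
  and inj_p: "inj_on p V"
  using embedding simple by (auto simp: plane_embedding_def simple_graph_def)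

lemma end_on_edge: "e \<in> E \<Longrightarrow> x \<in> e \<Longrightarrow> p x \<in> path_image (g e)"
  by (metis edge_ends imageI insertE pathfinish_in_path_image pathstart_in_path_image singletonD)

lemma path_vertices: "path_edges xs \<subseteq> E \<Longrightarrow> length xs \<ge> 2 \<Longrightarrow> set xs \<subseteq> V"
  using vertex_on_path_edge[of _ xs] edge_subset by (meson subset_iff)

lemma vertex_on_trace:
  "x \<in> set xs \<Longrightarrow> length xs \<ge> 2 \<Longrightarrow> path_edges xs \<subseteq> E \<Longrightarrow> p x \<in> path_trace xs"
  using vertex_on_path_edge[of x xs] end_on_edge unfolding path_trace_def by (meson UN_I subsetD)

lemma edge_as_arc:
  assumes "{x, y} \<in> E"
  obtains h where "arc h" "pathstart h = p x" "pathfinish h = p y"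
    "path_image h = path_image (g {x, y})"
proof (cases "pathstart (g {x, y}) = p x")
  case True
  then have "pathfinish (g {x, y}) = p y"
    using edge_ends[OF assms] edge_arc[OF assms] arc_distinct_ends[of "g {x, y}"]
    by (auto simp: doubleton_eq_iff)
  then show ?thesis using that[of "g {x, y}"] True edge_arc[OF assms] by blast
next
  case False
  then have "pathstart (g {x, y}) = p y" "pathfinish (g {x, y}) = p x"
    using edge_ends[OF assms] by (auto simp: doubleton_eq_iff)
  then show ?thesis
    using that[of "reversepath (g {x, y})"] edge_arc[OF assms] by (simp add: arc_reversepath)
qed

lemma traces_meet:
  assumes "path_edges xs \<subseteq> E" "path_edges ys \<subseteq> E" "path_edges xs \<inter> path_edges ys = {}"
  shows "path_trace xs \<inter> path_trace ys \<subseteq> p ` (set xs \<inter> set ys)"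
proof
  fix z assume "z \<in> path_trace xs \<inter> path_trace ys"
  then obtain e e' where e: "e \<in> path_edges xs" "e' \<in> path_edges ys"
    "z \<in> path_image (g e) \<inter> path_image (g e')" unfolding path_trace_def by blast
  then have "z \<in> p ` (e \<inter> e')" using edges_meet[of e e'] assms by blast
  then show "z \<in> p ` (set xs \<inter> set ys)"
    using path_edges_subset_set[OF e(1)] path_edges_subset_set[OF e(2)] by blast
qed

lemma path_as_arc:
  assumes "distinct xs" "length xs \<ge> 2" "path_edges xs \<subseteq> E"
  shows "\<exists>h. arc h \<and> pathstart h = p (hd xs) \<and> pathfinish h = p (last xs) \<and> path_image h = path_trace xs"
  using assms
proof (induction xs rule: path_edges.induct)
  case (1 x y zs)
  have xy: "{x, y} \<in> E" using "1.prems" by simp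
  obtain h where h: "arc h" "pathstart h = p x" "pathfinish h = p y"
    "path_image h = path_image (g {x, y})" using edge_as_arc[OF xy] .
  show ?case
  proof (cases "zs = []")
    case True
    then show ?thesis using h by (auto simp: path_trace_def)
  next
    case False
    then have "length (y # zs) \<ge> 2" by (cases zs) auto
    then obtain k where k: "arc k" "pathstart k = p y" "pathfinish k = p (last (y # zs))"
      "path_image k = path_trace (y # zs)"
      using "1.IH" "1.prems" by auto
    have "path_edges [x, y] \<inter> path_edges (y # zs) = {}"
      using path_edges_subset_set[of "{x, y}" "y # zs"] "1.prems"(1) by auto
    then have "path_trace [x, y] \<inter> path_trace (y # zs) \<subseteq> p ` (set [x, y] \<inter> set (y # zs))"
      using traces_meet[of "[x, y]" "y # zs"] "1.prems" by simp
    then have "path_image h \<inter> path_image k \<subseteq> {p y}"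
      using "1.prems"(1) h(4) k(4) by (auto simp: path_trace_def)
    then have "arc (h +++ k)" using arc_join[OF h(1) k(1)] h k by simp
    moreover have "path_image (h +++ k) = path_trace (x # y # zs)"
      using h k by (auto simp: path_image_join path_trace_def)
    ultimately show ?thesis using h k by (intro exI[of _ "h +++ k"]) auto
  qed
qed auto

lemma path_as_arc_between:
  assumes "distinct (a # W @ [b])" "path_edges (a # W @ [b]) \<subseteq> E"
  obtains h where "arc h" "pathstart h = p a" "pathfinish h = p b"
    "path_image h = path_trace (a # W @ [b])"
  using path_as_arc[OF assms(1) _ assms(2)] by auto

text \<open>Without an inner vertex on at least one of them, both paths could be the single edge from a to b.\<close>

lemma edge_disjoint_paths:
  assumes "distinct (a # b # X @ Y)" "X \<noteq> [] \<or> Y \<noteq> []"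
    and "path_edges (a # X @ [b]) \<subseteq> E" "path_edges (a # Y @ [b]) \<subseteq> E"
  shows "path_edges (a # X @ [b]) \<inter> path_edges (a # Y @ [b]) = {}"
proof (rule ccontr)
  assume "\<not> ?thesis"
  then obtain e where e: "e \<in> path_edges (a # X @ [b])" "e \<in> path_edges (a # Y @ [b])" by blast
  then have "e \<subseteq> {a, b}"
    using path_edges_subset_set[OF e(1)] path_edges_subset_set[OF e(2)] assms(1) by auto
  moreover have "card e = 2" using e assms edge_card by blast
  moreover have "card {a, b} = 2" using assms(1) by simp
  ultimately have "e = {a, b}" by (simp add: card_subset_eq)
  then show False using e end_edge_path[of a X b] end_edge_path[of a Y b] assms(1,2) by auto
qed

lemma parallel_traces:
  assumes "distinct (a # b # X @ Y)" "X \<noteq> [] \<or> Y \<noteq> []"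
    and "path_edges (a # X @ [b]) \<subseteq> E" "path_edges (a # Y @ [b]) \<subseteq> E"
  shows "path_trace (a # X @ [b]) \<inter> path_trace (a # Y @ [b]) = {p a, p b}"
proof
  have "set (a # X @ [b]) \<inter> set (a # Y @ [b]) = {a, b}" using assms(1) by auto
  then show "path_trace (a # X @ [b]) \<inter> path_trace (a # Y @ [b]) \<subseteq> {p a, p b}"
    using traces_meet[OF assms(3,4) edge_disjoint_paths[OF assms]] by auto
  show "{p a, p b} \<subseteq> path_trace (a # X @ [b]) \<inter> path_trace (a # Y @ [b])"
    using assms(3,4) by (auto intro!: vertex_on_trace)
qed

lemma compact_trace: "path_edges xs \<subseteq> E \<Longrightarrow> compact (path_trace xs)"
  unfolding path_trace_def
proof (rule compact_UN)
  show "finite (path_edges xs)" by (induction xs rule: path_edges.induct) auto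
  show "\<And>e. path_edges xs \<subseteq> E \<Longrightarrow> e \<in> path_edges xs \<Longrightarrow> compact (path_image (g e))"
    using edge_arc compact_arc_image by blast
qed

lemma F_avoids_trace: "path_edges xs \<subseteq> E \<Longrightarrow> F \<inter> path_trace xs = {}"
  using F_avoids unfolding path_trace_def drawing_def by blast

text \<open>This is how outerplanarity enters: the outer face lies outside every closed curve of the drawing,
  and the inside of the curve, being open, cannot even touch its closure.\<close>

lemma vertex_not_inside:
  assumes "path_edges xs \<subseteq> E" "path_edges ys \<subseteq> E" "v \<in> V"
  shows "p v \<notin> inside (path_trace xs \<union> path_trace ys)"
proof -
  have "F \<inter> (path_trace xs \<union> path_trace ys) = {}" using F_avoids_trace assms by blast
  then have "inside (path_trace xs \<union> path_trace ys) \<inter> closure F = {}"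
    using inside_avoids_closure_of_unbounded[OF connected_F unbounded_F] compact_trace assms
    by (simp add: compact_Un)
  then show ?thesis using on_F assms(3) by blast
qed

lemma inner_path_not_inside:
  assumes "distinct (a # X @ [b])" "X \<noteq> []" "path_edges (a # X @ [b]) \<subseteq> E"
    and "path_edges ys \<subseteq> E" "path_edges zs \<subseteq> E"
  shows "\<not> path_trace (a # X @ [b]) - {p a, p b} \<subseteq> inside (path_trace ys \<union> path_trace zs)"
proof -
  have sub: "set (a # X @ [b]) \<subseteq> V" by (rule path_vertices) (use assms(3) in auto)
  have "hd X \<in> set X" using assms(2) by simp
  then have "hd X \<in> V" "hd X \<noteq> a" "hd X \<noteq> b" "a \<in> V" "b \<in> V"
    using sub assms(1) by auto
  moreover from this have "p (hd X) \<noteq> p a" "p (hd X) \<noteq> p b"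
    using inj_onD[OF inj_p] by blast+
  moreover have "p (hd X) \<in> path_trace (a # X @ [b])"
    using \<open>hd X \<in> set X\<close> assms(3) by (intro vertex_on_trace) auto
  ultimately show ?thesis using vertex_not_inside[OF assms(4,5)] by blast
qed

text \<open>One of three parallel paths is enclosed by the other two. A path with an inner vertex is not,
  so when two of them have inner vertices it must be the third.\<close>

lemma third_path_inside:
  assumes "distinct (a # b # X @ Y @ Z)" "X \<noteq> []" "Y \<noteq> []"
    and X: "path_edges (a # X @ [b]) \<subseteq> E" and Y: "path_edges (a # Y @ [b]) \<subseteq> E"
    and Z: "path_edges (a # Z @ [b]) \<subseteq> E"
  shows "path_trace (a # Z @ [b]) - {p a, p b} \<subseteq> inside (path_trace (a # X @ [b]) \<union> path_trace (a # Y @ [b]))"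
proof -
  obtain c1 where c1: "arc c1" "pathstart c1 = p a" "pathfinish c1 = p b"
    and t1: "path_image c1 = path_trace (a # X @ [b])" using path_as_arc_between[OF _ X] assms(1) by auto
  obtain c2 where c2: "arc c2" "pathstart c2 = p a" "pathfinish c2 = p b"
    and t2: "path_image c2 = path_trace (a # Y @ [b])" using path_as_arc_between[OF _ Y] assms(1) by auto
  obtain c3 where c3: "arc c3" "pathstart c3 = p a" "pathfinish c3 = p b"
    and t3: "path_image c3 = path_trace (a # Z @ [b])" using path_as_arc_between[OF _ Z] assms(1) by auto
  have "path_image c1 \<inter> path_image c2 = {p a, p b}"
    unfolding t1 t2 by (rule parallel_traces) (use assms in auto)
  moreover have "path_image c1 \<inter> path_image c3 = {p a, p b}"
    unfolding t1 t3 by (rule parallel_traces) (use assms in auto)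
  moreover have "path_image c2 \<inter> path_image c3 = {p a, p b}"
    unfolding t2 t3 by (rule parallel_traces) (use assms in auto)
  ultimately have "path_image c1 - {p a, p b} \<subseteq> inside (path_image c2 \<union> path_image c3) \<or>
    path_image c2 - {p a, p b} \<subseteq> inside (path_image c1 \<union> path_image c3) \<or>
    path_image c3 - {p a, p b} \<subseteq> inside (path_image c1 \<union> path_image c2)"
    by (rule theta_some_arc_inside[OF c1 c2 c3])
  moreover have "distinct (a # X @ [b])" "distinct (a # Y @ [b])" using assms(1) by auto
  ultimately show ?thesis
    using inner_path_not_inside[OF _ assms(2) X Y Z] inner_path_not_inside[OF _ assms(3) Y X Z]
    unfolding t1 t2 t3 by blast
qed

text \<open>An outerplanar graph contains no subdivision of the complete bipartite graph with parts of sizes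
  two and three.\<close>

lemma no_three_inner_paths:
  assumes "distinct (a # b # X @ Y @ Z)" "X \<noteq> []" "Y \<noteq> []" "Z \<noteq> []"
    and "path_edges (a # X @ [b]) \<subseteq> E" "path_edges (a # Y @ [b]) \<subseteq> E"
      "path_edges (a # Z @ [b]) \<subseteq> E"
  shows False
  using third_path_inside[OF assms(1-3,5-7)] inner_path_not_inside[of a Z b] assms by auto

text \<open>Two crossing chords of a cycle would both run inside it, since each cuts the cycle into two paths
  with an inner vertex. The first chord splits the inside into two regions. The second chord avoids
  the first and so stays within one region, but each of its ends is off the closure of one of them.\<close>

lemma no_crossing_chords:
  assumes d: "distinct (a # X1 @ b # X2 @ c # Y1 @ d # Y2)"
    and cyc: "path_edges (a # X1 @ b # X2 @ c # Y1 @ d # Y2 @ [a]) \<subseteq> E"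
    and ac: "{a, c} \<in> E" and bd: "{b, d} \<in> E"
  shows False
proof -
  define A B C D where "A = path_edges (a # X1 @ [b])" and "B = path_edges (b # X2 @ [c])"
    and "C = path_edges (c # Y1 @ [d])" and "D = path_edges (d # Y2 @ [a])"
  note defs = A_def B_def C_def D_def
  have app: "path_edges (x # xs @ y # ys) = path_edges (x # xs @ [y]) \<union> path_edges (y # ys)" for x xs y ys
    using path_edges_append[of "x # xs" y ys] by simp
  have ABCD: "A \<union> B \<union> C \<union> D \<subseteq> E"
    using cyc app[of a X1 b "X2 @ c # Y1 @ d # Y2 @ [a]"] app[of b X2 c "Y1 @ d # Y2 @ [a]"]
      app[of c Y1 d "Y2 @ [a]"] unfolding defs by simp
  have e1: "path_edges (a # (X1 @ b # X2) @ [c]) = A \<union> B"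
    using app[of a X1 b "X2 @ [c]"] by (simp add: defs)
  have e2: "path_edges (a # rev (Y1 @ d # Y2) @ [c]) = C \<union> D"
    using app[of c Y1 d "Y2 @ [a]"] path_edges_rev[of "c # Y1 @ d # Y2 @ [a]"] by (simp add: defs)
  have e3: "path_edges (b # (X2 @ c # Y1) @ [d]) = B \<union> C"
    using app[of b X2 c "Y1 @ [d]"] by (simp add: defs)
  have e4: "path_edges (b # rev (Y2 @ a # X1) @ [d]) = D \<union> A"
    using app[of d Y2 a "X1 @ [b]"] path_edges_rev[of "d # Y2 @ a # X1 @ [b]"] by (simp add: defs)
  define J where "J = (\<Union>e\<in>A \<union> B \<union> C \<union> D. path_image (g e))"
  define S where "S = (\<lambda>x y. path_image (g {x, y}) - {p x, p y})"
  have tr: "path_trace (a # [] @ [c]) = path_image (g {a, c})" "path_trace (b # [] @ [d]) = path_image (g {b, d})"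
    by (auto simp: path_trace_def)
  \<comment> \<open>both chords run inside the cycle\<close>
  have J1: "path_trace (a # (X1 @ b # X2) @ [c]) \<union> path_trace (a # rev (Y1 @ d # Y2) @ [c]) = J"
    unfolding path_trace_def e1 e2 J_def by blast
  have "path_trace (a # [] @ [c]) - {p a, p c} \<subseteq>
    inside (path_trace (a # (X1 @ b # X2) @ [c]) \<union> path_trace (a # rev (Y1 @ d # Y2) @ [c]))"
    by (rule third_path_inside) (use d ABCD ac e1 e2 in auto)
  then have in1: "S a c \<subseteq> inside J" unfolding J1 tr S_def .
  have J2: "path_trace (b # (X2 @ c # Y1) @ [d]) \<union> path_trace (b # rev (Y2 @ a # X1) @ [d]) = J"
    unfolding path_trace_def e3 e4 J_def by blast
  have "path_trace (b # [] @ [d]) - {p b, p d} \<subseteq>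
    inside (path_trace (b # (X2 @ c # Y1) @ [d]) \<union> path_trace (b # rev (Y2 @ a # X1) @ [d]))"
    by (rule third_path_inside) (use d ABCD bd e3 e4 in auto)
  then have in2: "S b d \<subseteq> inside J" unfolding J2 tr S_def .
  \<comment> \<open>the chord from a to c separates b from d inside the cycle\<close>
  obtain c1 where c1: "arc c1" "pathstart c1 = p a" "pathfinish c1 = p c"
    and t1: "path_image c1 = path_trace (a # (X1 @ b # X2) @ [c])"
    by (rule path_as_arc_between[of a "(X1 @ b # X2)" c]) (use d e1 ABCD in auto)
  obtain c2 where c2: "arc c2" "pathstart c2 = p a" "pathfinish c2 = p c"
    and t2: "path_image c2 = path_trace (a # rev (Y1 @ d # Y2) @ [c])"
    by (rule path_as_arc_between[of a "rev (Y1 @ d # Y2)" c]) (use d e2 ABCD in auto)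
  obtain c3 where c3: "arc c3" "pathstart c3 = p a" "pathfinish c3 = p c"
    and t3: "path_image c3 = path_trace (a # [] @ [c])"
    by (rule path_as_arc_between[of a "[]" c]) (use d ac in auto)
  have i12: "path_image c1 \<inter> path_image c2 = {p a, p c}"
    unfolding t1 t2 by (rule parallel_traces) (use d ABCD e1 e2 in auto)
  have i13: "path_image c1 \<inter> path_image c3 = {p a, p c}"
    unfolding t1 t3 by (rule parallel_traces) (use d ABCD e1 ac in auto)
  have i23: "path_image c2 \<inter> path_image c3 = {p a, p c}"
    unfolding t2 t3 by (rule parallel_traces) (use d ABCD e2 ac in auto)
  have ne: "S x y \<noteq> {}" if "{x, y} \<in> E" for x y
  proof -
    have "p ` {x, y} = {pathstart (g {x, y}), pathfinish (g {x, y})}" using edge_ends[OF that] by simp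
    then have "S x y = g {x, y} ` {0<..<1}"
      using simple_path_endless[OF arc_imp_simple_path[OF edge_arc[OF that]]] unfolding S_def by simp
    then show ?thesis by simp
  qed
  have J12: "path_image c1 \<union> path_image c2 = J" unfolding t1 t2 J1 ..
  have "path_image c3 \<inter> inside (path_image c1 \<union> path_image c2) \<noteq> {}"
    unfolding J12 t3 tr using in1 ne[OF ac] unfolding S_def by blast
  moreover have "p a \<noteq> p c" using c1 arc_distinct_ends by metis
  ultimately obtain
    dis: "inside (path_image c1 \<union> path_image c3) \<inter> inside (path_image c2 \<union> path_image c3) = {}"
    and uni: "inside (path_image c1 \<union> path_image c3) \<union> inside (path_image c2 \<union> path_image c3) \<union>
      (path_image c3 - {p a, p c}) = inside (path_image c1 \<union> path_image c2)"
    using split_inside_simple_closed_curve[of c1 "p a" "p c" c2 c3]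
      c1 c2 c3 i12 i13 i23 arc_imp_simple_path by metis
  let ?I1 = "inside (path_image c1 \<union> path_image c3)" and ?I2 = "inside (path_image c2 \<union> path_image c3)"
  note j13 = jordan_two_arcs[OF c1 c3 i13] and j23 = jordan_two_arcs[OF c2 c3 i23]
  have bdac: "path_image (g {b, d}) \<inter> path_image (g {a, c}) = {}"
    using edges_meet[OF bd ac] d by (auto simp: doubleton_eq_iff)
  have cov: "S b d \<subseteq> ?I1 \<union> ?I2"
    using in2 uni bdac unfolding J12 t3 tr S_def by blast
  have con: "connected (S b d)"
  proof -
    have "p ` {b, d} = {pathstart (g {b, d}), pathfinish (g {b, d})}" using edge_ends[OF bd] by simp
    then show ?thesis
      using connected_simple_path_endless[OF arc_imp_simple_path[OF edge_arc[OF bd]]]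
      unfolding S_def by simp
  qed
  have cl: "p b \<in> closure (S b d)" "p d \<in> closure (S b d)"
  proof -
    obtain h where h: "arc h" "pathstart h = p b" "pathfinish h = p d"
      "path_image h = path_image (g {b, d})" using edge_as_arc[OF bd] .
    have "S b d = h ` {0<..<1}"
      using simple_path_endless[OF arc_imp_simple_path[OF h(1)]] h unfolding S_def by simp
    moreover have "h ` closure {0<..<1} \<subseteq> closure (h ` {0<..<1})"
      using h(1) by (intro continuous_image_closure_subset[of "{0..1}"])
        (auto simp: arc_def path_def)
    ultimately have "path_image h \<subseteq> closure (S b d)" by (simp add: path_image_def)
    then show "p b \<in> closure (S b d)" "p d \<in> closure (S b d)"
      using h pathstart_in_path_image[of h] pathfinish_in_path_image[of h] by auto
  qed
  have V: "a \<in> V" "b \<in> V" "c \<in> V" "d \<in> V" using ac bd edge_subset by auto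
  have on1: "p b \<in> path_image c1" unfolding t1
    by (rule vertex_on_trace) (use e1 ABCD in auto)
  have on2: "p d \<in> path_image c2" unfolding t2
    by (rule vertex_on_trace) (use e2 ABCD in auto)
  have neq: "p b \<noteq> p a" "p b \<noteq> p c" "p d \<noteq> p a" "p d \<noteq> p c"
    using V d inj_onD[OF inj_p] by auto
  have off: "p d \<notin> closure ?I1" "p b \<notin> closure ?I2"
  proof -
    have sub: "?I1 \<union> ?I2 \<subseteq> inside J" using uni J12 by blast
    have J: "p b \<in> J" "p d \<in> J" using on1 on2 J12 by auto
    have "p d \<notin> path_image c1 \<union> path_image c3" using on2 i12 i23 neq by blast
    moreover have "closure ?I1 \<subseteq> ?I1 \<union> (path_image c1 \<union> path_image c3)"
      using j13(5) by (metis closure_Un_frontier subset_refl)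
    ultimately show "p d \<notin> closure ?I1" using J(2) sub inside_no_overlap[of J] by blast
    have "p b \<notin> path_image c2 \<union> path_image c3" using on1 i12 i13 neq by blast
    moreover have "closure ?I2 \<subseteq> ?I2 \<union> (path_image c2 \<union> path_image c3)"
      using j23(5) by (metis closure_Un_frontier subset_refl)
    ultimately show "p b \<notin> closure ?I2" using J(1) sub inside_no_overlap[of J] by blast
  qed
  have "S b d \<subseteq> ?I1 \<or> S b d \<subseteq> ?I2"
    using connectedD[OF con j13(2) j23(2)] dis cov by blast
  then show False using off cl closure_mono by blast
qed

end

section \<open>Hamiltonian cycles of outerplanar graphs\<close>

lemma outerplanar_drawing:
  assumes "simple_graph V E" "outerplanar V E"
  obtains p g F where "outerplane_drawing V E p g F"
proof -
  obtain p g F where e: "plane_embedding V E p g" and F: "F \<in> components (- drawing V E p g)"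
    "\<not> bounded F" "p ` V \<subseteq> frontier F"
    using assms(2) unfolding outerplanar_def by blast
  have "outerplane_drawing V E p g F"
  proof
    show "connected F" using F(1) in_components_connected by blast
    show "F \<inter> drawing V E p g = {}" using in_components_subset[OF F(1)] by blast
    show "p ` V \<subseteq> closure F" using F(3) by (auto simp: frontier_def)
  qed (use assms(1) e F(2) in auto)
  then show ?thesis using that by blast
qed

definition graph_cycle :: "'a set set \<Rightarrow> 'a list \<Rightarrow> bool" where
  "graph_cycle E vs \<longleftrightarrow> distinct vs \<and> 3 \<le> length vs \<and> path_edges (vs @ [hd vs]) \<subseteq> E"

definition hamilton_cycle :: "'a set \<Rightarrow> 'a set set \<Rightarrow> 'a list \<Rightarrow> bool" where
  "hamilton_cycle V E vs \<longleftrightarrow> graph_cycle E vs \<and> set vs = V"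

lemma graph_cycle_append_swap:
  assumes "graph_cycle E (us @ ws)" shows "graph_cycle E (ws @ us)"
proof (cases "us = [] \<or> ws = []")
  case False
  then obtain u us' w ws' where "us = u # us'" "ws = w # ws'" by (meson neq_Nil_conv)
  then show ?thesis
    using assms path_edges_append[of us w "ws' @ [u]"] path_edges_append[of ws u "us' @ [w]"]
    by (auto simp: graph_cycle_def)
qed (use assms in auto)

lemma hamilton_cycle_rotate: "hamilton_cycle V E vs \<Longrightarrow> hamilton_cycle V E (rotate k vs)"
  using graph_cycle_append_swap[of E "take (k mod length vs) vs" "drop (k mod length vs) vs"]
  by (simp add: hamilton_cycle_def flip: rotate_drop_take)

text \<open>Stopping at the first visit to S, with loops cut out as they close.\<close>

lemma path_to_set:
  assumes "(y, b) \<in> {(x, y). {x, y} \<in> E}\<^sup>*" "b \<in> S"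
  shows "\<exists>xs. distinct xs \<and> xs \<noteq> [] \<and> hd xs = y \<and> last xs \<in> S \<and> set (butlast xs) \<inter> S = {} \<and>
    path_edges xs \<subseteq> E"
  using assms(1)
proof (induction rule: converse_rtrancl_induct)
  case base
  then show ?case using assms(2) by (intro exI[of _ "[b]"]) auto
next
  case (step y z)
  then obtain xs where xs: "distinct xs" "xs \<noteq> []" "hd xs = z" "last xs \<in> S"
    "set (butlast xs) \<inter> S = {}" "path_edges xs \<subseteq> E" by blast
  consider "y \<in> S" | "y \<notin> S" "y \<notin> set xs" | "y \<notin> S" "y \<in> set xs" by blast
  then show ?case
  proof cases
    case 1
    then show ?thesis by (intro exI[of _ "[y]"]) auto
  next
    case 2
    then show ?thesis using xs step.hyps(1) by (intro exI[of _ "y # xs"]) (auto simp: path_edges_Cons)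
  next
    case 3
    then obtain us ws where split: "xs = us @ y # ws" by (meson split_list)
    then show ?thesis
      using xs path_edges_append[of us y ws] by (intro exI[of _ "y # ws"]) (auto simp: butlast_append)
  qed
qed

lemma connected_graph_neighbour:
  assumes "connected_graph V E" "a \<in> V" "c \<in> V" "a \<noteq> c"
  obtains y where "{a, y} \<in> E"
proof -
  have "(a, c) \<in> {(x, y). {x, y} \<in> E}\<^sup>*" using assms unfolding connected_graph_def by blast
  then show ?thesis
  proof (cases rule: converse_rtranclE)
    case (step y)
    then show ?thesis using that[of y] by simp
  qed (use assms(4) in simp)
qed

lemma path_avoids_deleted_vertex:
  assumes "path_edges xs \<subseteq> {e \<in> E. a \<notin> e}" "xs \<noteq> []" "hd xs \<noteq> a"
  shows "a \<notin> set xs"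
proof
  assume a: "a \<in> set xs"
  then have "length xs \<ge> 2" using assms(2,3) by (cases xs; cases "tl xs") auto
  then show False using vertex_on_path_edge[OF a] assms(1) by blast
qed

text \<open>A vertex a has two neighbours y and z, the second one because the graph without y is connected; a
  path from y to z in the graph without a closes up to a cycle.\<close>

lemma two_connected_has_cycle:
  assumes "simple_graph V E" "two_connected V E"
  shows "\<exists>vs. graph_cycle E vs \<and> set vs \<subseteq> V"
proof -
  have card: "card V \<ge> 3" and con: "connected_graph V E"
    and del: "\<And>v. v \<in> V \<Longrightarrow> connected_graph (V - {v}) {e \<in> E. v \<notin> e}"
    using assms(2) unfolding two_connected_def by auto
  have E: "\<And>e. e \<in> E \<Longrightarrow> e \<subseteq> V \<and> card e = 2" using assms(1) unfolding simple_graph_def by blast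
  have third: "\<exists>d\<in>V. d \<noteq> u \<and> d \<noteq> v" for u v
  proof (rule ccontr)
    assume "\<not> ?thesis"
    then have "card V \<le> card {u, v}" by (intro card_mono) auto
    also have "\<dots> \<le> 2" by (simp add: card_insert_if)
    finally show False using card by simp
  qed
  obtain a where aV: "a \<in> V" using third by blast
  obtain c where "c \<in> V" "c \<noteq> a" using third by blast
  with aV have ac: "a \<in> V" "c \<in> V" "a \<noteq> c" by auto
  obtain y where y: "{a, y} \<in> E" using connected_graph_neighbour[OF con ac] .
  then have yV: "y \<in> V" "y \<noteq> a" using E[OF y] by auto
  obtain d where "d \<in> V" "d \<noteq> a" "d \<noteq> y" using third by blast
  then obtain z where z: "{a, z} \<in> {e \<in> E. y \<notin> e}"
    using connected_graph_neighbour[OF del[OF yV(1)], of a d] ac(1) yV(2) by auto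
  then have zV: "z \<in> V" "z \<noteq> a" "z \<noteq> y" using E[of "{a, z}"] by auto
  have "(y, z) \<in> {(u, v). {u, v} \<in> {e \<in> E. a \<notin> e}}\<^sup>*"
    using del[OF ac(1)] yV zV unfolding connected_graph_def by blast
  from path_to_set[OF this, of "{z}"] obtain xs where xs: "distinct xs" "xs \<noteq> []" "hd xs = y"
    "last xs = z" "path_edges xs \<subseteq> {e \<in> E. a \<notin> e}" by auto
  have a: "a \<notin> set xs" using path_avoids_deleted_vertex xs yV(2) by metis
  have len: "length xs \<ge> 2" using xs zV(3) by (cases xs; cases "tl xs") auto
  have "path_edges ((a # xs) @ [hd (a # xs)]) = insert {a, y} (insert {z, a} (path_edges xs))"
    using xs by (simp add: path_edges_Cons path_edges_snoc)
  then have "graph_cycle E (a # xs)"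
    unfolding graph_cycle_def using a len xs y z by (auto simp: insert_commute)
  moreover have "set xs \<subseteq> V"
    using vertex_on_path_edge[OF _ len] xs(5) E by blast
  ultimately show ?thesis using ac(1) by (intro exI[of _ "a # xs"]) auto
qed

text \<open>An edge leaving the cycle at a is continued in the graph without a until it returns to the cycle;
  deleting a forces the ear to return at a different vertex.\<close>

lemma two_connected_ear:
  assumes "simple_graph V E" "two_connected V E" "graph_cycle E vs" "set vs \<subseteq> V" "set vs \<noteq> V"
  obtains a b Y where "a \<in> set vs" "b \<in> set vs" "a \<noteq> b" "Y \<noteq> []" "distinct Y" "set Y \<inter> set vs = {}"
    "set Y \<subseteq> V" "path_edges (a # Y @ [b]) \<subseteq> E"
proof -
  have con: "connected_graph V E"
    and del: "\<And>v. v \<in> V \<Longrightarrow> connected_graph (V - {v}) {e \<in> E. v \<notin> e}"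
    using assms(2) unfolding two_connected_def by auto
  have E: "\<And>e. e \<in> E \<Longrightarrow> e \<subseteq> V \<and> card e = 2" using assms(1) unfolding simple_graph_def by blast
  have vs: "distinct vs" "length vs \<ge> 3" using assms(3) unfolding graph_cycle_def by auto
  obtain x where x: "x \<in> set vs" using vs(2) by (cases vs) auto
  obtain w where w: "w \<in> V" "w \<notin> set vs" using assms(4,5) by blast
  have "\<exists>a y. a \<in> set vs \<and> y \<notin> set vs \<and> {a, y} \<in> E"
  proof (rule ccontr)
    assume no: "\<not> ?thesis"
    have "(x, w) \<in> {(x, y). {x, y} \<in> E}\<^sup>*"
      using con x w assms(4) unfolding connected_graph_def by blast
    then have "w \<in> set vs" by (induction rule: rtrancl_induct) (use x no in auto)
    then show False using w(2) by simp
  qed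
  then obtain a y where ay: "a \<in> set vs" "y \<notin> set vs" "{a, y} \<in> E" by blast
  have V: "a \<in> V" "y \<in> V" "y \<noteq> a" using E[OF ay(3)] ay by auto
  have "card (set vs) \<ge> 3" using vs distinct_card by metis
  then have "\<not> set vs \<subseteq> {a}" using card_mono[of "{a}" "set vs"] by auto
  then obtain c where c: "c \<in> set vs" "c \<noteq> a" by blast
  have "(y, c) \<in> {(u, v). {u, v} \<in> {e \<in> E. a \<notin> e}}\<^sup>*"
    using del[OF V(1)] V c assms(4) unfolding connected_graph_def by blast
  from path_to_set[OF this, of "set vs - {a}"] c obtain xs where
    xs: "distinct xs" "xs \<noteq> []" "hd xs = y" "last xs \<in> set vs - {a}"
      "set (butlast xs) \<inter> (set vs - {a}) = {}" "path_edges xs \<subseteq> {e \<in> E. a \<notin> e}" by auto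
  have a: "a \<notin> set xs" using path_avoids_deleted_vertex xs V(3) by metis
  define Y b where "Y = butlast xs" and "b = last xs"
  have Yb: "xs = Y @ [b]" using xs(2) by (simp add: Y_def b_def)
  have Y: "Y \<noteq> []" using xs(3,4) ay(2) Yb by auto
  show ?thesis
  proof (rule that[of a b Y])
    show "path_edges (a # Y @ [b]) \<subseteq> E"
      using xs(2,3,6) ay(3) Yb by (auto simp: path_edges_Cons)
    have "length xs \<ge> 2" using Y Yb by (cases Y) auto
    then have "set xs \<subseteq> V"
      using vertex_on_path_edge[of _ xs] xs(6) E by blast
    then show "set Y \<subseteq> V" using Yb by auto
    show "set Y \<inter> set vs = {}" using xs(5) a unfolding Y_def by (auto dest: in_set_butlastD)
    show "b \<in> set vs" "a \<noteq> b" using xs(4) by (auto simp: b_def)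
    show "distinct Y" using xs(1) Yb by simp
  qed (rule ay(1) Y)+
qed

lemma cycle_through_two_vertices:
  assumes "graph_cycle E vs" "a \<in> set vs" "b \<in> set vs" "a \<noteq> b"
  obtains X Z where "graph_cycle E (a # X @ b # Z)" "set (a # X @ b # Z) = set vs"
    "length (a # X @ b # Z) = length vs"
proof -
  obtain us ws where s: "vs = us @ a # ws" using split_list[OF assms(2)] by blast
  have c: "graph_cycle E (a # ws @ us)" using graph_cycle_append_swap[of E us "a # ws"] assms(1) s by simp
  have "b \<in> set (ws @ us)" using assms s by auto
  then obtain X Z where XZ: "ws @ us = X @ b # Z" by (meson split_list)
  have "set (a # ws @ us) = set vs" "length (a # ws @ us) = length vs" using s by auto
  then show ?thesis using that[of X Z] c unfolding XZ by blast
qed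

text \<open>A longest cycle is Hamiltonian. Otherwise it has an ear. If the ends of the ear are adjacent on the
  cycle, then replacing the edge between them by the ear gives a longer cycle; if not, the ear and
  the two halves of the cycle are three parallel paths with inner vertices.\<close>

theorem outerplanar_two_connected_hamiltonian:
  assumes "simple_graph V E" "two_connected V E" "outerplanar V E"
  obtains vs where "hamilton_cycle V E vs"
proof -
  obtain p g F where "outerplane_drawing V E p g F" using outerplanar_drawing assms by blast
  then interpret outerplane_drawing V E p g F .
  have fin: "finite V" using assms(1) unfolding simple_graph_def by blast
  have bound: "length us < Suc (card V)" if "graph_cycle E us \<and> set us \<subseteq> V" for us
    using that fin card_mono[of V "set us"] by (auto simp: graph_cycle_def distinct_card)
  obtain us where "graph_cycle E us \<and> set us \<subseteq> V"
    using two_connected_has_cycle[OF assms(1,2)] by blast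
  then have "\<exists>vs. (graph_cycle E vs \<and> set vs \<subseteq> V) \<and>
      (\<forall>us. graph_cycle E us \<and> set us \<subseteq> V \<longrightarrow> length us \<le> length vs)"
    by (rule ex_has_greatest_nat[where b = "Suc (card V)"]) (use bound in blast)
  then obtain vs where vs: "graph_cycle E vs" "set vs \<subseteq> V"
    and longest: "\<And>us. graph_cycle E us \<Longrightarrow> set us \<subseteq> V \<Longrightarrow> length us \<le> length vs"
    by blast
  have "set vs = V"
  proof (rule ccontr)
    assume "set vs \<noteq> V"
    then obtain a b Y where ab: "a \<in> set vs" "b \<in> set vs" "a \<noteq> b"
      and Y: "Y \<noteq> []" "distinct Y" "set Y \<inter> set vs = {}" "set Y \<subseteq> V" "path_edges (a # Y @ [b]) \<subseteq> E"
      using two_connected_ear[OF assms(1,2) vs] by metis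
    obtain X Z where c: "graph_cycle E (a # X @ b # Z)" and set: "set (a # X @ b # Z) = set vs"
      and len: "length (a # X @ b # Z) = length vs"
      using cycle_through_two_vertices[OF vs(1) ab] by metis
    have d: "distinct (a # X @ b # Z)" using c unfolding graph_cycle_def by blast
    have "path_edges (a # X @ b # Z @ [a]) \<subseteq> E" using c unfolding graph_cycle_def by simp
    then have eX: "path_edges (a # X @ [b]) \<subseteq> E" and eZ: "path_edges (b # Z @ [a]) \<subseteq> E"
      using path_edges_append[of "a # X" b "Z @ [a]"] by auto
    have eZ': "path_edges (a # rev Z @ [b]) \<subseteq> E" using path_edges_rev[of "b # Z @ [a]"] eZ by simp
    have eY': "path_edges (b # rev Y @ [a]) \<subseteq> E" using path_edges_rev[of "a # Y @ [b]"] Y(5) by simp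
    have disj: "set Y \<inter> set (a # X @ b # Z) = {}" using Y(3) set by simp
    consider "X = []" | "Z = []" | "X \<noteq> []" "Z \<noteq> []" by blast
    then show False
    proof cases
      case 1
      have "graph_cycle E (a # Y @ b # Z)"
        unfolding graph_cycle_def
        using path_edges_append[of "a # Y" b "Z @ [a]"] Y eZ d disj len vs(1) 1
        by (auto simp: graph_cycle_def)
      moreover have "set (a # Y @ b # Z) \<subseteq> V" using Y(4) set vs(2) by auto
      ultimately have "length (a # Y @ b # Z) \<le> length vs" by (rule longest)
      then show False using len 1 Y(1) by (cases Y) auto
    next
      case 2
      have "graph_cycle E (a # X @ b # rev Y)"
        unfolding graph_cycle_def
        using path_edges_append[of "a # X" b "rev Y @ [a]"] Y eX eY' d disj len vs(1) 2
        by (auto simp: graph_cycle_def)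
      moreover have "set (a # X @ b # rev Y) \<subseteq> V" using Y(4) set vs(2) by auto
      ultimately have "length (a # X @ b # rev Y) \<le> length vs" by (rule longest)
      then show False using len 2 Y(1) by (cases Y) auto
    next
      case 3
      show False
        by (rule no_three_inner_paths[of a b X Y "rev Z"]) (use 3 Y d disj eX eZ' in auto)
    qed
  qed
  then show ?thesis using that vs(1) unfolding hamilton_cycle_def by blast
qed

lemma hamilton_chords_cross_at_0:
  assumes "simple_graph V E" "outerplanar V E" "hamilton_cycle V E vs"
    and "0 < j" "j < k" "k < l" "l < length vs"
    and "{vs ! 0, vs ! k} \<in> E" "{vs ! j, vs ! l} \<in> E"
  shows False
proof -
  obtain p g F where "outerplane_drawing V E p g F" using outerplanar_drawing assms by blast
  then interpret outerplane_drawing V E p g F .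
  have split: "take m vs = take i vs @ vs ! i # drop (Suc i) (take m vs)" if "i < m" "m \<le> length vs" for i m
    using id_take_nth_drop[of i "take m vs"] that by (simp add: min_def)
  obtain Y2 where 1: "vs = take l vs @ vs ! l # Y2" using id_take_nth_drop[of l vs] assms by blast
  obtain Y1 where 2: "take l vs = take k vs @ vs ! k # Y1" using split[of k l] assms by auto
  obtain X2 where 3: "take k vs = take j vs @ vs ! j # X2" using split[of j k] assms by auto
  obtain X1 where 4: "take j vs = vs ! 0 # X1" using split[of 0 j] assms by auto
  have vs: "vs = vs ! 0 # X1 @ vs ! j # X2 @ vs ! k # Y1 @ vs ! l # Y2"
    using 1 unfolding 2 3 4 by simp
  have "hd vs = vs ! 0" using assms(7) by (intro hd_conv_nth) auto
  then have "distinct vs" "path_edges (vs @ [vs ! 0]) \<subseteq> E"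
    using assms(3) unfolding hamilton_cycle_def graph_cycle_def by auto
  then have "distinct (vs ! 0 # X1 @ vs ! j # X2 @ vs ! k # Y1 @ vs ! l # Y2)"
    "path_edges (vs ! 0 # X1 @ vs ! j # X2 @ vs ! k # Y1 @ vs ! l # Y2 @ [vs ! 0]) \<subseteq> E"
    using arg_cong[OF vs, of distinct] arg_cong[OF vs, of "\<lambda>us. path_edges (us @ [vs ! 0])"]
    by simp_all
  then show False using no_crossing_chords assms(8,9) by blast
qed

text \<open>Rotating the cycle moves the first of the four ends to position 0.\<close>

theorem hamilton_chords_noncrossing:
  assumes "simple_graph V E" "outerplanar V E" "hamilton_cycle V E vs"
    and "i < j" "j < k" "k < l" "l < length vs"
    and "{vs ! i, vs ! k} \<in> E" "{vs ! j, vs ! l} \<in> E"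
  shows False
proof (rule hamilton_chords_cross_at_0[OF assms(1,2) hamilton_cycle_rotate[OF assms(3), of i]])
  show "0 < j - i" "j - i < k - i" "k - i < l - i" "l - i < length (rotate i vs)"
    using assms by auto
  have "rotate i vs ! (m - i) = vs ! m" if "i \<le> m" "m < length vs" for m
    using that by (subst nth_rotate) auto
  from this[of i] this[of j] this[of k] this[of l]
  show "{rotate i vs ! 0, rotate i vs ! (k - i)} \<in> E" "{rotate i vs ! (j - i), rotate i vs ! (l - i)} \<in> E"
    using assms by auto
qed

section \<open>Colouring a cycle with disjoint chords\<close>

lemma path_edges_nth: "path_edges xs = {{xs ! i, xs ! Suc i} |i. Suc i < length xs}"
proof (induction xs rule: path_edges.induct)
  case (1 x y zs)
  have "{{(x # y # zs) ! i, (x # y # zs) ! Suc i} |i. Suc i < length (x # y # zs)} =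
    insert {x, y} {{(y # zs) ! i, (y # zs) ! Suc i} |i. Suc i < length (y # zs)}"
    (is "?L = insert _ ?R")
  proof
    show "?L \<subseteq> insert {x, y} ?R"
    proof
      fix e assume "e \<in> ?L"
      then obtain i where i: "e = {(x # y # zs) ! i, (x # y # zs) ! Suc i}" "Suc i < length (x # y # zs)"
        by blast
      show "e \<in> insert {x, y} ?R"
      proof (cases i)
        case (Suc m)
        then have "e = {(y # zs) ! m, (y # zs) ! Suc m}" "Suc m < length (y # zs)" using i by auto
        then show ?thesis by blast
      qed (use i in simp)
    qed
    have "{x, y} \<in> ?L" by (rule CollectI) (rule exI[of _ 0], simp)
    moreover have "?R \<subseteq> ?L"
    proof
      fix e assume "e \<in> ?R"
      then obtain i where "e = {(y # zs) ! i, (y # zs) ! Suc i}" "Suc i < length (y # zs)" by blast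
      then show "e \<in> ?L" by (intro CollectI exI[of _ "Suc i"]) simp
    qed
    ultimately show "insert {x, y} ?R \<subseteq> ?L" by blast
  qed
  then show ?case using 1 by simp
qed auto

lemma card_4: "distinct [p, q, r, s] \<Longrightarrow> card {p, q, r, s} = 4"
  using distinct_card[of "[p, q, r, s]"] by simp

lemma three_distinct_within_two_interval:
  fixes p q r :: nat
  assumes "p \<noteq> q" "p \<noteq> r" "q \<noteq> r"
    and "p \<le> q + 2" "q \<le> p + 2" "p \<le> r + 2" "r \<le> p + 2" "q \<le> r + 2" "r \<le> q + 2"
  shows "\<exists>a b. {p, q, r} = {a..b}"
proof (intro exI)
  show "{p, q, r} = {min p (min q r)..min p (min q r) + 2}"
    using assms by auto
qed

text \<open>Vertices are addressed by their position on the Hamiltonian cycle: edge i of the cycle joins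
  positions i and i + 1, so that position i lies between the edges pred i and i. Since degrees are
  at most 3, each position is the end of at most one chord.\<close>

locale subcubic_hamilton_graph =
  fixes V :: "'a set" and E :: "'a set set" and vs :: "'a list"
  assumes simple: "simple_graph V E" and hamilton: "hamilton_cycle V E vs"
    and degree_le_3: "\<And>v. v \<in> V \<Longrightarrow> vertex_degree E v \<le> 3"
begin

abbreviation n :: nat where "n \<equiv> length vs"

definition cycle_edge :: "nat \<Rightarrow> 'a set" where "cycle_edge i = {vs ! i, vs ! (Suc i mod n)}"

definition pred :: "nat \<Rightarrow> nat" where "pred i = (if i = 0 then n - 1 else i - 1)"

definition chord :: "nat \<Rightarrow> nat \<Rightarrow> bool" where
  "chord i j \<longleftrightarrow> i < n \<and> j < n \<and> {vs ! i, vs ! j} \<in> E - cycle_edge ` {..<n}"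

lemma n_ge_3: "3 \<le> n" and dist: "distinct vs" and set_vs: "set vs = V"
  using hamilton by (auto simp: hamilton_cycle_def graph_cycle_def)

lemma finite_V: "finite V" and edgeD: "e \<in> E \<Longrightarrow> e \<subseteq> V \<and> card e = 2"
  using simple by (auto simp: simple_graph_def)

lemma finite_E: "finite E"
  by (rule finite_subset[of _ "Pow V"]) (use edgeD finite_V in auto)

lemma nth_eq: "i < n \<Longrightarrow> j < n \<Longrightarrow> vs ! i = vs ! j \<longleftrightarrow> i = j"
  using dist by (rule nth_eq_iff_index_eq)

lemma cycle_edge_in_E: "i < n \<Longrightarrow> cycle_edge i \<in> E"
proof -
  assume i: "i < n"
  have "hd vs = vs ! 0" using n_ge_3 by (intro hd_conv_nth) auto
  then have "cycle_edge i = {(vs @ [hd vs]) ! i, (vs @ [hd vs]) ! Suc i}"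
    using i by (cases "Suc i = n") (auto simp: cycle_edge_def nth_append)
  then have "cycle_edge i \<in> path_edges (vs @ [hd vs])" unfolding path_edges_nth using i by auto
  then show ?thesis using hamilton by (auto simp: hamilton_cycle_def graph_cycle_def)
qed

lemma Suc_mod: "i < n \<Longrightarrow> Suc i mod n = (if Suc i = n then 0 else Suc i)" by auto

lemma pred_less: "i < n \<Longrightarrow> pred i < n" using n_ge_3 by (auto simp: pred_def)

lemma nth_in_cycle_edge: "i < n \<Longrightarrow> m < n \<Longrightarrow> vs ! m \<in> cycle_edge i \<longleftrightarrow> m = i \<or> i = pred m"
proof -
  assume a: "i < n" "m < n"
  have "Suc i mod n < n" using a(1) by (intro mod_less_divisor) linarith
  then have "vs ! m \<in> cycle_edge i \<longleftrightarrow> m = i \<or> m = Suc i mod n"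
    using a nth_eq[OF a(2,1)] nth_eq[OF a(2), of "Suc i mod n"] by (auto simp: cycle_edge_def)
  then show ?thesis using a by (auto simp: Suc_mod pred_def)
qed

lemma cycle_edge_inj: "i < n \<Longrightarrow> j < n \<Longrightarrow> cycle_edge i = cycle_edge j \<Longrightarrow> i = j"
proof (rule ccontr)
  assume a: "i < n" "j < n" "cycle_edge i = cycle_edge j" "i \<noteq> j"
  have "vs ! i \<in> cycle_edge j" "vs ! j \<in> cycle_edge i" using a by (auto simp: cycle_edge_def)
  then have "j = pred i" "i = pred j"
    using nth_in_cycle_edge[OF a(2,1)] nth_in_cycle_edge[OF a(1,2)] a(4) by auto
  then show False using n_ge_3 a(4) by (auto simp: pred_def split: if_splits)
qed

lemma pred_neq: "i < n \<Longrightarrow> pred i \<noteq> i" using n_ge_3 by (auto simp: pred_def)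

lemma chord_sym: "chord i j \<Longrightarrow> chord j i" by (auto simp: chord_def insert_commute)

lemma chord_neq: "chord i j \<Longrightarrow> i \<noteq> j" using edgeD[of "{vs ! i, vs ! j}"] by (auto simp: chord_def)

lemma edge_cases:
  assumes "e \<in> E"
  obtains i where "i < n" "e = cycle_edge i" | i j where "chord i j" "e = {vs ! i, vs ! j}"
proof -
  obtain u v where e: "e = {u, v}" using edgeD[OF assms] by (auto simp: card_2_iff)
  then have "u \<in> set vs" "v \<in> set vs" using edgeD[OF assms] set_vs by auto
  then obtain i j where "i < n" "u = vs ! i" "j < n" "v = vs ! j" by (metis in_set_conv_nth)
  then show ?thesis using that e assms by (cases "e \<in> cycle_edge ` {..<n}") (auto simp: chord_def)
qed

lemma edges_at:
  assumes "m < n"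
  shows "{e \<in> E. vs ! m \<in> e} = {cycle_edge (pred m), cycle_edge m} \<union> {{vs ! m, vs ! j} |j. chord m j}"
proof
  show "{e \<in> E. vs ! m \<in> e} \<subseteq> {cycle_edge (pred m), cycle_edge m} \<union> {{vs ! m, vs ! j} |j. chord m j}"
  proof
    fix e assume "e \<in> {e \<in> E. vs ! m \<in> e}"
    then have e: "e \<in> E" "vs ! m \<in> e" by auto
    from e(1) show "e \<in> {cycle_edge (pred m), cycle_edge m} \<union> {{vs ! m, vs ! j} |j. chord m j}"
    proof (cases rule: edge_cases)
      case (1 i)
      then show ?thesis using nth_in_cycle_edge[of i m] assms e(2) by auto
    next
      case (2 i j)
      then have "m = i \<or> m = j" using e(2) assms nth_eq by (auto simp: chord_def)
      then show ?thesis using 2 chord_sym by (auto simp: insert_commute)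
    qed
  qed
  show "{cycle_edge (pred m), cycle_edge m} \<union> {{vs ! m, vs ! j} |j. chord m j} \<subseteq> {e \<in> E. vs ! m \<in> e}"
    using assms cycle_edge_in_E pred_less nth_in_cycle_edge[of _ m] by (auto simp: chord_def)
qed

lemma cycle_edge_pred_neq: "m < n \<Longrightarrow> cycle_edge (pred m) \<noteq> cycle_edge m"
  using cycle_edge_inj pred_less pred_neq by blast

lemma chord_unique:
  assumes "chord m i" "chord m j" shows "i = j"
proof (rule ccontr)
  assume ij: "i \<noteq> j"
  have m: "m < n" "i < n" "j < n" using assms by (auto simp: chord_def)
  let ?S = "{cycle_edge (pred m), cycle_edge m, {vs ! m, vs ! i}, {vs ! m, vs ! j}}"
  have "{vs ! m, vs ! i} \<noteq> {vs ! m, vs ! j}"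
    using ij m nth_eq by (auto simp: doubleton_eq_iff)
  moreover have "{vs ! m, vs ! i} \<notin> {cycle_edge (pred m), cycle_edge m}"
    "{vs ! m, vs ! j} \<notin> {cycle_edge (pred m), cycle_edge m}"
    using assms m pred_less[OF m(1)] by (auto simp: chord_def)
  ultimately have "card ?S = 4"
    using cycle_edge_pred_neq[OF m(1)] by (intro card_4) (simp only: distinct.simps list.set insert_iff empty_iff, metis)
  moreover have "?S \<subseteq> {e \<in> E. vs ! m \<in> e}" unfolding edges_at[OF m(1)] using assms by auto
  then have "card ?S \<le> vertex_degree E (vs ! m)"
    unfolding vertex_degree_def by (rule card_mono[rotated]) (simp add: finite_E)
  moreover have "vs ! m \<in> V" using m set_vs by auto
  ultimately show False using degree_le_3[of "vs ! m"] by linarith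
qed

text \<open>A colouring is described by the colours f of the cycle edges and the colours g of the chords, a
  chord being given the same colour at both of its ends; the choice between the two ends in the
  definition is then immaterial.\<close>

definition colouring :: "(nat \<Rightarrow> nat) \<Rightarrow> (nat \<Rightarrow> nat) \<Rightarrow> 'a set \<Rightarrow> nat" where
  "colouring f g e = (if e \<in> cycle_edge ` {..<n} then f (THE i. i < n \<and> e = cycle_edge i)
     else g (SOME i. i < n \<and> vs ! i \<in> e))"

lemma colouring_cycle_edge: "i < n \<Longrightarrow> colouring f g (cycle_edge i) = f i"
proof -
  assume i: "i < n"
  then have "(THE j. j < n \<and> cycle_edge i = cycle_edge j) = i" using cycle_edge_inj by (intro the_equality) auto
  then show ?thesis using i by (auto simp: colouring_def)
qed

lemma colouring_chord:
  assumes "\<And>i j. chord i j \<Longrightarrow> g i = g j" "chord i j"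
  shows "colouring f g {vs ! i, vs ! j} = g i"
proof -
  have ij: "i < n" "j < n" "{vs ! i, vs ! j} \<notin> cycle_edge ` {..<n}" using assms(2) by (auto simp: chord_def)
  define m where "m = (SOME m. m < n \<and> vs ! m \<in> {vs ! i, vs ! j})"
  have "m < n \<and> vs ! m \<in> {vs ! i, vs ! j}" unfolding m_def by (rule someI[of _ i]) (use ij in simp)
  then have "m = i \<or> m = j" using ij nth_eq by auto
  then have "g m = g i" using assms by metis
  then show ?thesis using ij(3) unfolding colouring_def m_def by simp
qed

text \<open>The condition on a chord end says that its three colours are distinct and pairwise at most 2
  apart, that is, three consecutive integers.\<close>

lemma interval_coloring_of_pattern:
  assumes sym: "\<And>i j. chord i j \<Longrightarrow> g i = g j"
    and two: "\<And>i. i < n \<Longrightarrow> (\<And>j. \<not> chord i j) \<Longrightarrow> f i = Suc (f (pred i)) \<or> f (pred i) = Suc (f i)"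
    and three: "\<And>i j. chord i j \<Longrightarrow> f i \<noteq> f (pred i) \<and> f i \<noteq> g i \<and> f (pred i) \<noteq> g i \<and>
      f i \<le> f (pred i) + 2 \<and> f (pred i) \<le> f i + 2 \<and> f i \<le> g i + 2 \<and> g i \<le> f i + 2 \<and>
      f (pred i) \<le> g i + 2 \<and> g i \<le> f (pred i) + 2"
    and f_range: "\<And>i. i < n \<Longrightarrow> f i \<in> {1..t}"
    and g_range: "\<And>i j. chord i j \<Longrightarrow> g i \<in> {1..t}"
    and onto: "\<And>c. c \<in> {1..t} \<Longrightarrow> (\<exists>i<n. f i = c) \<or> (\<exists>i j. chord i j \<and> g i = c)"
  shows "interval_coloring V E t (colouring f g)"
proof -
  let ?\<alpha> = "colouring f g"
  have vertex: "\<exists>m<n. v = vs ! m" if "v \<in> V" for v using that set_vs by (metis in_set_conv_nth)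
  have at: "?\<alpha> ` {e \<in> E. vs ! m \<in> e} = {f (pred m), f m} \<and> f (pred m) \<noteq> f m" if "m < n" "\<And>j. \<not> chord m j" for m
    using two[OF that(1)] that unfolding edges_at[OF that(1)]
    by (auto simp: colouring_cycle_edge pred_less)
  have at_chord: "{e \<in> E. vs ! m \<in> e} = {cycle_edge (pred m), cycle_edge m, {vs ! m, vs ! j}}"
    if j: "chord m j" for m j
  proof -
    have "{{vs ! m, vs ! k} |k. chord m k} = {{vs ! m, vs ! j}}" using j chord_unique by blast
    then show ?thesis using edges_at[of m] j by (simp add: chord_def insert_commute)
  qed
  have col: "?\<alpha> (cycle_edge (pred m)) = f (pred m)" "?\<alpha> (cycle_edge m) = f m" if "m < n" for m
    using that by (auto simp: colouring_cycle_edge pred_less)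
  have colch: "?\<alpha> {vs ! i, vs ! j} = g i" if "chord i j" for i j
    by (rule colouring_chord) (use sym that in auto)
  have "proper_edge_coloring E ?\<alpha>"
    unfolding proper_edge_coloring_def
  proof (intro ballI impI)
    fix e e' assume e: "e \<in> E" "e' \<in> E" "e \<noteq> e' \<and> e \<inter> e' \<noteq> {}"
    then obtain v where v: "v \<in> e" "v \<in> e'" by blast
    then obtain m where m: "m < n" "v = vs ! m" using vertex edgeD[OF e(1)] by blast
    have in_at: "e \<in> {e \<in> E. vs ! m \<in> e}" "e' \<in> {e \<in> E. vs ! m \<in> e}" using e v m by auto
    show "?\<alpha> e \<noteq> ?\<alpha> e'"
    proof (cases "\<exists>j. chord m j")
      case True
      then obtain j where j: "chord m j" by blast
      show ?thesis
        using in_at e(3) three[OF j] col[OF m(1)] colch[OF j]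
        unfolding at_chord[OF j] insert_iff empty_iff by metis
    next
      case False
      then have "e \<in> {cycle_edge (pred m), cycle_edge m}" "e' \<in> {cycle_edge (pred m), cycle_edge m}"
        using in_at edges_at[OF m(1)] by simp_all
      moreover have "f (pred m) \<noteq> f m" using at[OF m(1)] False by blast
      ultimately show ?thesis
        using e(3) col[OF m(1)] unfolding insert_iff empty_iff by metis
    qed
  qed
  moreover have "?\<alpha> ` E = {1..t}"
  proof -
    have "E \<subseteq> cycle_edge ` {..<n} \<union> {{vs ! i, vs ! j} |i j. chord i j}"
    proof
      fix e assume "e \<in> E"
      then show "e \<in> cycle_edge ` {..<n} \<union> {{vs ! i, vs ! j} |i j. chord i j}"
        by (cases rule: edge_cases) blast+
    qed
    moreover have "{{vs ! i, vs ! j} |i j. chord i j} \<subseteq> E" unfolding chord_def by blast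
    ultimately have "E = cycle_edge ` {..<n} \<union> {{vs ! i, vs ! j} |i j. chord i j}"
      using cycle_edge_in_E by blast
    then have "?\<alpha> ` E = ?\<alpha> ` (cycle_edge ` {..<n}) \<union> ?\<alpha> ` {{vs ! i, vs ! j} |i j. chord i j}"
      by (metis image_Un)
    also have "?\<alpha> ` (cycle_edge ` {..<n}) = f ` {..<n}"
      unfolding image_image by (rule image_cong) (auto simp: colouring_cycle_edge)
    also have "?\<alpha> ` {{vs ! i, vs ! j} |i j. chord i j} = g ` {i. \<exists>j. chord i j}"
    proof
      show "?\<alpha> ` {{vs ! i, vs ! j} |i j. chord i j} \<subseteq> g ` {i. \<exists>j. chord i j}"
        using colch by blast
      show "g ` {i. \<exists>j. chord i j} \<subseteq> ?\<alpha> ` {{vs ! i, vs ! j} |i j. chord i j}"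
      proof clarify
        fix i j assume "chord i j"
        then show "g i \<in> ?\<alpha> ` {{vs ! i, vs ! j} |i j. chord i j}"
          by (intro image_eqI[of _ _ "{vs ! i, vs ! j}"]) (use colch in auto)
      qed
    qed
    also have "f ` {..<n} \<union> g ` {i. \<exists>j. chord i j} = {1..t}"
    proof
      show "f ` {..<n} \<union> g ` {i. \<exists>j. chord i j} \<subseteq> {1..t}" using f_range g_range by blast
      show "{1..t} \<subseteq> f ` {..<n} \<union> g ` {i. \<exists>j. chord i j}" using onto by blast
    qed
    finally show ?thesis .
  qed
  moreover have "\<exists>a b. spectrum_at E ?\<alpha> v = {a..b}" if v: "v \<in> V" for v
  proof -
    obtain m where m: "m < n" "v = vs ! m" using vertex[OF v] by blast
    show ?thesis
    proof (cases "\<exists>j. chord m j")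
      case True
      then obtain j where j: "chord m j" by blast
      have "spectrum_at E ?\<alpha> v = {f m, f (pred m), g m}"
        unfolding spectrum_at_def m(2) at_chord[OF j]
        using col[OF m(1)] colch[OF j] by auto
      then show ?thesis using three_distinct_within_two_interval[of "f m" "f (pred m)" "g m"] three[OF j] by simp
    next
      case False
      then have s: "spectrum_at E ?\<alpha> v = {f (pred m), f m}"
        using at[OF m(1)] unfolding spectrum_at_def m(2) by auto
      have "{f (pred m), f m} = {min (f m) (f (pred m))..max (f m) (f (pred m))}"
        using two[OF m(1)] False by auto
      then show ?thesis using s by metis
    qed
  qed
  ultimately show ?thesis unfolding interval_coloring_def by blast
qed

lemma degree_ge_2: "v \<in> V \<Longrightarrow> 2 \<le> vertex_degree E v"
proof -
  assume "v \<in> V"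
  then obtain m where m: "m < n" "v = vs ! m" using set_vs by (metis in_set_conv_nth)
  have "card {cycle_edge (pred m), cycle_edge m} = 2" using cycle_edge_pred_neq[OF m(1)] by simp
  moreover have "card {cycle_edge (pred m), cycle_edge m} \<le> vertex_degree E v"
    unfolding vertex_degree_def m(2) edges_at[OF m(1), symmetric]
    by (rule card_mono) (simp add: finite_E, simp add: edges_at[OF m(1)])
  ultimately show ?thesis by simp
qed

lemma degree_3_chord:
  assumes "v \<in> V" "vertex_degree E v = 3"
  obtains i j where "chord i j"
proof -
  obtain m where m: "m < n" "v = vs ! m" using assms(1) set_vs by (metis in_set_conv_nth)
  have "\<exists>j. chord m j"
  proof (rule ccontr)
    assume "\<not> ?thesis"
    then have "{e \<in> E. v \<in> e} = {cycle_edge (pred m), cycle_edge m}" using edges_at[OF m(1)] m(2) by simp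
    then have "vertex_degree E v = 2"
      unfolding vertex_degree_def using cycle_edge_pred_neq[OF m(1)] by simp
    then show False using assms(2) by simp
  qed
  then show ?thesis using that by blast
qed

text \<open>On an even cycle the colours 1 and 2 alternate, and all chords have colour 3.\<close>

lemma even_interval_3_coloring:
  assumes "even n" "chord a b"
  shows "\<exists>\<alpha>. interval_coloring V E 3 \<alpha>"
proof
  have par: "even (pred i) \<longleftrightarrow> odd i" if "i < n" for i
    using assms(1) that n_ge_3 by (auto simp: pred_def)
  let ?f = "\<lambda>i::nat. if even i then 1 else 2 :: nat"
  show "interval_coloring V E 3 (colouring ?f (\<lambda>_. 3))"
  proof (rule interval_coloring_of_pattern)
    fix c :: nat assume "c \<in> {1..3}"
    then consider "c = ?f 0" | "c = ?f 1" | "c = 3" by force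
    then show "(\<exists>i<n. ?f i = c) \<or> (\<exists>i j. chord i j \<and> 3 = c)"
    proof cases
      case 1
      have "0 < n" using n_ge_3 by linarith
      then show ?thesis using 1 by blast
    next
      case 2
      have "1 < n" using n_ge_3 by linarith
      then show ?thesis using 2 by blast
    next
      case 3
      then show ?thesis using assms(2) by blast
    qed
  next
    fix i j assume "chord i j"
    then show "?f i \<noteq> ?f (pred i) \<and> ?f i \<noteq> 3 \<and> ?f (pred i) \<noteq> 3 \<and>
      ?f i \<le> ?f (pred i) + 2 \<and> ?f (pred i) \<le> ?f i + 2 \<and> ?f i \<le> 3 + 2 \<and> 3 \<le> ?f i + 2 \<and>
      ?f (pred i) \<le> 3 + 2 \<and> 3 \<le> ?f (pred i) + 2"
      using par[of i] unfolding chord_def by simp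
  qed (simp_all add: par)
qed

end

section \<open>Lower bounds on the number of colours\<close>

lemma interval_coloring_ge_3:
  assumes "simple_graph V E" "v \<in> V" "vertex_degree E v = 3" "interval_coloring V E t \<alpha>"
  shows "3 \<le> t"
proof -
  let ?S = "{e \<in> E. v \<in> e}"
  have proper: "proper_edge_coloring E \<alpha>" and img: "\<alpha> ` E = {1..t}"
    using assms(4) by (auto simp: interval_coloring_def)
  have "inj_on \<alpha> ?S" using proper by (auto simp: inj_on_def proper_edge_coloring_def)
  then have "card (\<alpha> ` ?S) = 3" using assms(3) by (simp add: card_image vertex_degree_def)
  moreover have "\<alpha> ` ?S \<subseteq> {1..t}" using img by auto
  then have "card (\<alpha> ` ?S) \<le> card {1..t}" by (intro card_mono) auto
  ultimately show ?thesis by simp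
qed

text \<open>An interval of at least two colours out of 1, 2, 3 contains 2, so the edges of colour 2 form a
  perfect matching.\<close>

lemma interval_3_coloring_even:
  assumes "simple_graph V E" "\<And>v. v \<in> V \<Longrightarrow> 2 \<le> vertex_degree E v"
    and "interval_coloring V E 3 \<alpha>"
  shows "even (card V)"
proof -
  have proper: "proper_edge_coloring E \<alpha>" and img: "\<alpha> ` E = {1..3}"
    and int: "\<And>v. v \<in> V \<Longrightarrow> \<exists>a b. spectrum_at E \<alpha> v = {a..b}"
    using assms(3) by (auto simp: interval_coloring_def)
  have E: "\<And>e. e \<in> E \<Longrightarrow> e \<subseteq> V \<and> card e = 2" and fin: "finite V"
    using assms(1) unfolding simple_graph_def by auto
  define M where "M = {e \<in> E. \<alpha> e = 2}"
  have cover: "\<exists>e\<in>M. v \<in> e" if v: "v \<in> V" for v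
  proof -
    obtain a b where ab: "spectrum_at E \<alpha> v = {a..b}" using int[OF v] by blast
    have sub: "{a..b} \<subseteq> {1..3}" unfolding ab[symmetric] img[symmetric] spectrum_at_def by blast
    have "inj_on \<alpha> {e \<in> E. v \<in> e}" using proper by (auto simp: inj_on_def proper_edge_coloring_def)
    then have "2 \<le> card {a..b}"
      using assms(2)[OF v] card_image unfolding ab[symmetric] spectrum_at_def vertex_degree_def by metis
    then have "a < b" by simp
    then have "a \<in> {1..3}" "b \<in> {1..3}" using sub by auto
    then have "2 \<in> {a..b}" using \<open>a < b\<close> by simp
    then have "2 \<in> \<alpha> ` {e \<in> E. v \<in> e}" unfolding ab[symmetric] spectrum_at_def .
    then obtain e where "2 = \<alpha> e" "e \<in> {e \<in> E. v \<in> e}" by (rule imageE)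
    then show ?thesis unfolding M_def by (intro bexI[of _ e]) simp_all
  qed
  have "\<Union> M = V" using cover E by (auto simp: M_def)
  moreover have "2 * card M = card (\<Union> M)"
  proof (rule card_partition)
    have "finite (Pow V)" using fin by simp
    then show "finite M" by (rule finite_subset[rotated]) (use E in \<open>auto simp: M_def\<close>)
    show "finite (\<Union> M)" using \<open>\<Union> M = V\<close> fin by simp
    show "card c = 2" if "c \<in> M" for c using that E by (auto simp: M_def)
    show "c1 \<inter> c2 = {}" if "c1 \<in> M" "c2 \<in> M" "c1 \<noteq> c2" for c1 c2
      using that proper unfolding M_def proper_edge_coloring_def by (metis (mono_tags, lifting) mem_Collect_eq)
  qed
  ultimately show ?thesis by (metis dvd_triv_left)
qed

section \<open>Four colours for odd order\<close>

context subcubic_hamilton_graph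
begin

lemma chord_not_Suc: "chord i j \<Longrightarrow> j \<noteq> Suc i"
  unfolding chord_def cycle_edge_def by (auto simp: image_iff)

definition noncrossing :: bool where
  "noncrossing \<longleftrightarrow> (\<forall>i j k m. i < j \<and> j < k \<and> k < m \<longrightarrow> \<not> (chord i k \<and> chord j m))"

text \<open>No chord leaves the segment of positions cut off by another chord.\<close>

lemma chord_segment_closed:
  assumes noncrossing "chord a b" "a < b" "chord x y"
  shows "a \<le> x \<and> x \<le> b \<longleftrightarrow> a \<le> y \<and> y \<le> b"
proof -
  have stays: "a \<le> y \<and> y \<le> b" if "chord x y" "a \<le> x" "x \<le> b" for x y
  proof (cases "x = a \<or> x = b")
    case True
    then have "y = a \<or> y = b" using that(1) assms(2) chord_unique chord_sym by blast
    then show ?thesis using assms(3) by auto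
  next
    case False
    then have "a < x" "x < b" using that by auto
    then show ?thesis
      using assms(1,2) that(1) chord_sym unfolding noncrossing_def by (meson not_le)
  qed
  show ?thesis using stays[OF assms(4)] stays[OF chord_sym[OF assms(4)]] by blast
qed

text \<open>Around an odd cycle the parities of the colours cannot alternate throughout, so some position sees
  two cycle edges of equal parity. Here these are 1 and 3, with a chord of colour 2, and the way back
  between 3 and 1 goes through a step between 3 and 2 elsewhere, at a position with no chord or with
  a chord of colour 4. Segments of the cycle are coloured in one of the schemes 1, 2 with chords 3,
  or 3, 4 with chords 2, or 2, 3 with chords 4; each segment must be closed under chords, and the
  schemes must fit where segments meet.

  Minimality of the odd chord from 0 to l provides such segments near position 1. Its interior has
  an even, nonzero number of positions, and it is partitioned into single vertices of degree 2 and
  segments cut off by outermost chords, each with an odd number of positions; hence there are at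
  least two such parts. The cases below are the possibilities for the first two: two single
  vertices; a single vertex and then a chord; a chord followed by a single vertex or by a second
  chord.\<close>

lemma odd_interval_4_coloring:
  assumes odd: "odd n"
    and noncross: noncrossing
    and l: "chord 0 l" "odd l"
    and minimal: "\<And>i j. 0 < i \<Longrightarrow> i < j \<Longrightarrow> j < l \<Longrightarrow> chord i j \<Longrightarrow> even (j - i)"
  shows "\<exists>\<alpha>. interval_coloring V E 4 \<alpha>"
proof -
  note closed = chord_segment_closed[OF noncross]
  have ln: "l < n" using l(1) unfolding chord_def by blast
  have "l \<noteq> 1" "l \<noteq> 0" using chord_not_Suc[OF l(1)] chord_neq[OF l(1)] by auto
  then have l3: "3 \<le> l" using l(2) by presburger
  have n5: "5 \<le> n" using l3 ln odd l(2) by presburger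
  have inner: "0 < y \<and> y < l" if "chord x y" "0 < x" "x < l" for x y
  proof -
    have "y \<le> l" using closed[OF l(1) _ that(1)] that l3 by simp
    moreover have "y \<noteq> 0" using chord_unique[OF _ l(1), of x] chord_sym[OF that(1)] that(3) by (cases y) auto
    moreover have "y \<noteq> l"
      using chord_unique[OF _ chord_sym[OF l(1)], of x] chord_sym[OF that(1)] that(2) by (cases "y = l") auto
    ultimately show ?thesis by linarith
  qed
  have parn: "even (n - Suc 0)" using odd by simp
  consider (none) "\<And>j. \<not> chord 1 j" "\<And>j. \<not> chord 2 j"
    | (second) j where "\<And>j. \<not> chord 1 j" "chord 2 j"
    | (first) j where "chord 1 j" by blast
  then show ?thesis
  proof cases
    case none
    \<comment> \<open>jump from 3 to 1 at position 0, where the chord has colour 2; position 2 has edges 2 and 3\<close>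
    define f :: "nat \<Rightarrow> nat"
      where "f = (\<lambda>i. if i = 0 then 1 else if i = 1 then 2 else if even i then 3 else 4)"
    have "interval_coloring V E 4 (colouring f (\<lambda>_. 2))"
    proof (rule interval_coloring_of_pattern)
      fix i assume i: "i < n" "\<And>j. \<not> chord i j"
      have "i \<noteq> 0" using i(2) l(1) by metis
      then show "f i = Suc (f (pred i)) \<or> f (pred i) = Suc (f i)"
        by (cases i) (auto simp: f_def pred_def)
    next
      fix i j assume "chord i j"
      then have "i \<noteq> 1" "i \<noteq> 2" using none by metis+
      then show "f i \<noteq> f (pred i) \<and> f i \<noteq> 2 \<and> f (pred i) \<noteq> 2 \<and>
        f i \<le> f (pred i) + 2 \<and> f (pred i) \<le> f i + 2 \<and> f i \<le> 2 + 2 \<and> 2 \<le> f i + 2 \<and>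
        f (pred i) \<le> 2 + 2 \<and> 2 \<le> f (pred i) + 2"
        using parn n5 by (cases i) (auto simp: f_def pred_def)
    next
      fix c :: nat assume "c \<in> {1..4}"
      then have "c = f 0 \<or> c = f 1 \<or> c = f 2 \<or> c = f 3" by (auto simp: f_def)
      moreover have "0 < n" "1 < n" "2 < n" "3 < n" using n5 by linarith+
      ultimately show "(\<exists>i<n. f i = c) \<or> (\<exists>i j. chord i j \<and> 2 = c)" by metis
    qed (auto simp: f_def)
    then show ?thesis by blast
  next
    case (second j)
    have "0 < j" "j < l" using inner[OF second(2)] l3 by auto
    moreover have "j \<noteq> 1" using second(1) chord_sym[OF second(2)] by metis
    ultimately have j: "2 < j" "j < l" using chord_neq[OF second(2)] by auto
    have evj: "even j" using minimal[of 2 j] second(2) j by auto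
    \<comment> \<open>jump from 3 to 1 at j, where the chord has colour 2; position 1 has edges 2 and 3\<close>
    define f :: "nat \<Rightarrow> nat"
      where "f = (\<lambda>i. if i = 0 then 2 else if i < j then (if even i then 4 else 3) else if even i then 1 else 2)"
    define g :: "nat \<Rightarrow> nat" where "g = (\<lambda>i. if 2 \<le> i \<and> i \<le> j then 2 else 3)"
    have "interval_coloring V E 4 (colouring f g)"
    proof (rule interval_coloring_of_pattern)
      fix x y assume "chord x y"
      then show "g x = g y" using closed[OF second(2) j(1)] by (simp add: g_def)
    next
      fix i assume i: "i < n" "\<And>m. \<not> chord i m"
      have "i \<noteq> 0" "i \<noteq> j" using i(2) l(1) chord_sym[OF second(2)] by metis+
      then show "f i = Suc (f (pred i)) \<or> f (pred i) = Suc (f i)"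
        using j by (cases i) (auto simp: f_def pred_def)
    next
      fix i k assume "chord i k"
      then have "i \<noteq> 1" using second by metis
      then show "f i \<noteq> f (pred i) \<and> f i \<noteq> g i \<and> f (pred i) \<noteq> g i \<and>
        f i \<le> f (pred i) + 2 \<and> f (pred i) \<le> f i + 2 \<and> f i \<le> g i + 2 \<and> g i \<le> f i + 2 \<and>
        f (pred i) \<le> g i + 2 \<and> g i \<le> f (pred i) + 2"
        using j ln parn evj by (cases i; cases "i = j") (auto simp: f_def g_def pred_def)
    next
      fix c :: nat assume "c \<in> {1..4}"
      then have "c = f j \<or> c = f 0 \<or> c = f 1 \<or> c = f 2" using j evj by (auto simp: f_def)
      moreover have "0 < n" "1 < n" "2 < n" "j < n" using j ln by linarith+
      ultimately show "(\<exists>i<n. f i = c) \<or> (\<exists>i j. chord i j \<and> g i = c)" by metis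
    qed (auto simp: f_def g_def)
    then show ?thesis by blast
  next
    case (first j)
    have "0 < j" "j < l" using inner[OF first] l3 by auto
    then have j: "1 < j" "j < l" using chord_neq[OF first] by auto
    have oddj: "odd j" using minimal[of 1 j] first j by auto
    have j3: "3 \<le> j" using j(1) oddj by presburger
    have jl: "j + 1 < l" using j(2) oddj l(2) by presburger
    \<comment> \<open>k = j + 1 stands for an empty second segment, when j + 1 has degree 2\<close>
    have "\<exists>k. even k \<and> j < k \<and> k < l \<and> (if k = j + 1 then \<forall>m. \<not> chord k m else chord (j + 1) k)"
    proof (cases "\<exists>k. chord (j + 1) k")
      case True
      then obtain k where k: "chord (j + 1) k" by blast
      then have "0 < k" "k < l" using inner[OF k] jl by auto
      moreover have "\<not> (1 \<le> k \<and> k \<le> j)" using closed[OF first j(1) k] by auto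
      ultimately have "j < k" "k < l" "k \<noteq> j + 1" using chord_neq[OF k] by auto
      moreover from this have "even (k - (j + 1))" using minimal[of "j + 1" k] k by auto
      ultimately show ?thesis using k oddj by (intro exI[of _ k]) auto
    next
      case False
      then show ?thesis using oddj jl by (intro exI[of _ "j + 1"]) auto
    qed
    then obtain k where k: "even k" "j < k" "k < l"
      and next_chord: "if k = j + 1 then \<forall>m. \<not> chord k m else chord (j + 1) k" by blast
    \<comment> \<open>jump from 1 to 3 at position 1, where the chord has colour 2; the edge after j has colour 3 and is
      followed at j + 1 by an edge of colour 2, with chord colour 4 in the case of a second chord; at k
      the scheme 2, 3 gives way to the scheme 1, 2\<close>
    define f :: "nat \<Rightarrow> nat"
      where "f = (\<lambda>i. if i = 0 then 1 else if i \<le> j then (if even i then 4 else 3)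
        else if i < k then (if even i then 2 else 3) else if even i then 2 else 1)"
    define g :: "nat \<Rightarrow> nat"
      where "g = (\<lambda>i. if 1 \<le> i \<and> i \<le> j then 2 else if j + 1 \<le> i \<and> i \<le> k then 4 else 3)"
    have "interval_coloring V E 4 (colouring f g)"
    proof (rule interval_coloring_of_pattern)
      fix x y assume xy: "chord x y"
      have "1 \<le> x \<and> x \<le> j \<longleftrightarrow> 1 \<le> y \<and> y \<le> j" using closed[OF first j(1) xy] .
      moreover have "j + 1 \<le> x \<and> x \<le> k \<longleftrightarrow> j + 1 \<le> y \<and> y \<le> k"
      proof (cases "k = j + 1")
        case True
        then show ?thesis using next_chord xy chord_sym[OF xy] by (metis le_antisym)
      next
        case False
        then show ?thesis using closed[of "j + 1" k, OF _ _ xy] next_chord k(2) by auto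
      qed
      ultimately show "g x = g y" by (simp add: g_def)
    next
      fix i assume i: "i < n" "\<And>m. \<not> chord i m"
      have "i \<noteq> 0" "i \<noteq> 1" using i(2) l(1) first by metis+
      then show "f i = Suc (f (pred i)) \<or> f (pred i) = Suc (f i)"
        using j k oddj by (cases i; cases "i = j + 1"; cases "i = k") (auto simp: f_def pred_def)
    next
      fix i m assume "chord i m"
      show "f i \<noteq> f (pred i) \<and> f i \<noteq> g i \<and> f (pred i) \<noteq> g i \<and>
        f i \<le> f (pred i) + 2 \<and> f (pred i) \<le> f i + 2 \<and> f i \<le> g i + 2 \<and> g i \<le> f i + 2 \<and>
        f (pred i) \<le> g i + 2 \<and> g i \<le> f (pred i) + 2"
        using j k ln parn oddj by (cases i; cases "i = j + 1"; cases "i = k") (auto simp: f_def g_def pred_def)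
    next
      fix c :: nat assume "c \<in> {1..4}"
      then have "c = f 0 \<or> c = f (j + 1) \<or> c = f 1 \<or> c = f 2" using j3 oddj by (auto simp: f_def)
      moreover have "0 < n" "1 < n" "2 < n" "j + 1 < n" using jl l3 ln by linarith+
      ultimately show "(\<exists>i<n. f i = c) \<or> (\<exists>i j. chord i j \<and> g i = c)" by metis
    qed (auto simp: f_def g_def)
    then show ?thesis by blast
  qed
qed

end

text \<open>Each chord of an odd cycle cuts off an odd arc on one of its sides. The shortest odd arc is taken
  over all Hamiltonian cycles at once, so that after a rotation it starts at position 0; a chord of
  odd length inside it would, after a further rotation, be a shorter one.\<close>

lemma odd_hamilton_interval_4_coloring:
  assumes simple: "simple_graph V E" and outer: "outerplanar V E"
    and deg: "\<And>v. v \<in> V \<Longrightarrow> vertex_degree E v \<le> 3"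
    and w: "w \<in> V" "vertex_degree E w = 3"
    and ham: "hamilton_cycle V E us" and odd: "odd (card V)"
  shows "\<exists>\<alpha>. interval_coloring V E 4 \<alpha>"
proof -
  have loc: "subcubic_hamilton_graph V E vs" if "hamilton_cycle V E vs" for vs
    by standard (use simple that deg in auto)
  have len: "length vs = card V" if "hamilton_cycle V E vs" for vs
    using that by (auto simp: hamilton_cycle_def graph_cycle_def distinct_card)
  define Q where "Q l \<longleftrightarrow> (\<exists>vs. hamilton_cycle V E vs \<and> odd l \<and> subcubic_hamilton_graph.chord E vs 0 l)" for l
  \<comment> \<open>starting the cycle at i turns a chord from i to j into one from 0 to j - i, modulo the length\<close>
  have rot: "subcubic_hamilton_graph.chord E (rotate i vs) 0 ((j + length vs - i) mod length vs)"
    if vs: "hamilton_cycle V E vs" and c: "subcubic_hamilton_graph.chord E vs i j" for vs i j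
  proof -
    interpret A: subcubic_hamilton_graph V E vs by (rule loc[OF vs])
    interpret B: subcubic_hamilton_graph V E "rotate i vs" by (rule loc[OF hamilton_cycle_rotate[OF vs]])
    have ij: "i < length vs" "j < length vs" using c A.chord_def by auto
    let ?k = "(j + length vs - i) mod length vs"
    have k: "?k < length vs" using ij by (intro mod_less_divisor) linarith
    have 0: "rotate i vs ! 0 = vs ! i" using ij by (subst nth_rotate) auto
    have 1: "rotate i vs ! ?k = vs ! j"
      using ij k by (subst nth_rotate) (auto simp: mod_add_right_eq)
    have "B.cycle_edge m = A.cycle_edge ((i + m) mod length vs)" if "m < length vs" for m
    proof -
      have "Suc m mod length vs < length vs" using that by (intro mod_less_divisor) linarith
      then show ?thesis
        using that by (simp add: A.cycle_edge_def B.cycle_edge_def nth_rotate mod_Suc_eq mod_add_right_eq)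
    qed
    then have "B.cycle_edge ` {..<length vs} \<subseteq> A.cycle_edge ` {..<length vs}"
      using ij by (auto intro!: imageI mod_less_divisor)
    then show ?thesis
      using c ij k unfolding A.chord_def B.chord_def 0 1 by auto
  qed
  have diff: "(j + length vs - i) mod length vs = (if i \<le> j then j - i else length vs - (i - j))"
    if "i < length vs" "j < length vs" for i j and vs :: "'a list"
    using that by (auto simp: mod_if)
  interpret U: subcubic_hamilton_graph V E us by (rule loc[OF ham])
  obtain i j where ij: "U.chord i j" using U.degree_3_chord[OF w] by blast
  have lt: "i < length us" "j < length us" "i \<noteq> j" using ij U.chord_neq U.chord_def by auto
  have "\<exists>l. Q l"
  proof -
    have "Q ((j + length us - i) mod length us) \<or> Q ((i + length us - j) mod length us)"
    proof -
      have "odd ((j + length us - i) mod length us) \<or> odd ((i + length us - j) mod length us)"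
        unfolding diff[OF lt(1,2)] diff[OF lt(2,1)] using lt odd len[OF ham] by auto
      then show ?thesis
        unfolding Q_def using rot[OF ham ij] rot[OF ham U.chord_sym[OF ij]] hamilton_cycle_rotate[OF ham] by blast
    qed
    then show ?thesis by blast
  qed
  then obtain l where l: "Q l" and least: "\<And>m. m < l \<Longrightarrow> \<not> Q m"
    using exists_least_iff[of Q] by blast
  then obtain vs where vs: "hamilton_cycle V E vs" "odd l" "subcubic_hamilton_graph.chord E vs 0 l"
    unfolding Q_def by blast
  interpret A: subcubic_hamilton_graph V E vs by (rule loc[OF vs(1)])
  show ?thesis
  proof (rule A.odd_interval_4_coloring)
    show "odd (length vs)" using len[OF vs(1)] odd by simp
    show "A.chord 0 l" "odd l" by (fact vs(3), fact vs(2))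
    show A.noncrossing
      using hamilton_chords_noncrossing[OF simple outer vs(1)]
      unfolding A.noncrossing_def A.chord_def by blast
  next
    fix i j assume a: "0 < i" "i < j" "j < l" "A.chord i j"
    have "i < length vs" "j < length vs" using a(4) A.chord_def by auto
    then have "A.chord i j \<Longrightarrow> subcubic_hamilton_graph.chord E (rotate i vs) 0 (j - i)"
      using rot[OF vs(1) a(4)] diff[of i vs j] a(2) by simp
    then show "even (j - i)"
      using least[of "j - i"] a hamilton_cycle_rotate[OF vs(1)] unfolding Q_def by force
  qed
qed

section \<open>The least number of colours\<close>

theorem theorem3:
  fixes V :: "'a set" and E :: "'a set set"
  assumes "simple_graph V E"
    and "two_connected V E"
    and "outerplanar V E"
    and "max_degree V E = 3"
  shows "interval_colorable V E \<and>
         min_interval_colors V E = (if even (card V) then 3 else 4)"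
proof -
  obtain vs where vs: "hamilton_cycle V E vs"
    using outerplanar_two_connected_hamiltonian[OF assms(1-3)] .
  have fin: "finite (vertex_degree E ` V)" "vertex_degree E ` V \<noteq> {}"
    using assms(1,2) by (auto simp: simple_graph_def two_connected_def connected_graph_def)
  have deg: "vertex_degree E v \<le> 3" if "v \<in> V" for v
    using Max_ge[OF fin(1)] that assms(4) unfolding max_degree_def by force
  obtain w where w: "w \<in> V" "vertex_degree E w = 3"
    using Max_in[OF fin] assms(4) unfolding max_degree_def by auto
  interpret subcubic_hamilton_graph V E vs by standard (use assms(1) vs deg in auto)
  have len: "length vs = card V" using dist set_vs distinct_card by metis
  define t :: nat where "t = (if even (card V) then 3 else 4)"
  have "\<exists>\<alpha>. interval_coloring V E t \<alpha>"
  proof (cases "even (card V)")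
    case True
    obtain a b where "chord a b" using degree_3_chord[OF w] .
    then show ?thesis using even_interval_3_coloring[of a b] True len by (simp add: t_def)
  next
    case False
    then show ?thesis
      using odd_hamilton_interval_4_coloring[OF assms(1,3) deg w vs] by (simp add: t_def)
  qed
  then have ex: "t \<ge> 1 \<and> (\<exists>\<alpha>. interval_coloring V E t \<alpha>)" by (simp add: t_def)
  have lower: "t \<le> s" if s: "s \<ge> 1 \<and> (\<exists>\<alpha>. interval_coloring V E s \<alpha>)" for s
  proof -
    obtain \<alpha> where \<alpha>: "interval_coloring V E s \<alpha>" using s by blast
    have "3 \<le> s" by (rule interval_coloring_ge_3[OF assms(1) w \<alpha>])
    moreover have "s \<noteq> 3" if "odd (card V)"
      using interval_3_coloring_even[OF assms(1) degree_ge_2] \<alpha> that by blast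
    ultimately show ?thesis by (auto simp: t_def)
  qed
  have "min_interval_colors V E = t"
    unfolding min_interval_colors_def by (intro Least_equality) (use ex lower in blast)+
  then show ?thesis using ex unfolding interval_colorable_def t_def by blast
qed

end
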